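(* Let $k\ge3$ be a fixed integer. Then w.h.p. $G^*_{\min}(n,\alpha n)$ is $k$-connected if $\alpha>h_k$, and is not $k$-connected if $\alpha<h_k$.
   Context: Process $\{G^*_{\min}(n,m)\}_{m\ge0}$: $G^*_{\min}(n,0)$ is the empty multigraph on $[n]$; $G^*_{\min}(n,m+1)$ is obtained by choosing a vertex $u$ uniformly at random among the vertices with the smallest number of distinct neighbours, and joining it by a new edge to a vertex $v$ chosen uniformly at random from $[n]\setminus\{u\}$ (multiple edges allowed). Min-degree process $\{G_{\min}(n,m)\}$: start from the empty graph on $[n]$; each step chooses a vertex $u$ of minimum degree uniformly at random and joins it to a uniformly random vertex $v\ne u$ not already adjacent to $u$. $h_k$ denotes the constant (whose existence is due to Wormald) such that w.h.p. the first $m$ with $\delta(G_{\min}(n,m))\ge k$ equals $(h_k+o(1))n$. *)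

theory Defs
  imports "HOL-Probability.Probability"
begin

text \<open>
  The vertex set is \<open>{1..n}\<close> and an edge is a two-element set of vertices. A simple graph is given by
  its set of edges, a multigraph by its multiset of edges; notions that ignore multiplicities are
  defined for edge sets and applied to a multigraph \<open>M\<close> through \<open>set_mset M\<close>.
\<close>

definition neighbours :: "'a set set \<Rightarrow> 'a \<Rightarrow> 'a set" where
  "neighbours E u = {v. v \<noteq> u \<and> {u, v} \<in> E}"

definition min_degree :: "nat \<Rightarrow> nat set set \<Rightarrow> nat" where
  "min_degree n E = Min ((\<lambda>u. card (neighbours E u)) ` {1..n})"

definition min_vertices :: "nat \<Rightarrow> nat set set \<Rightarrow> nat set" where
  "min_vertices n E = {u \<in> {1..n}. card (neighbours E u) = min_degree n E}"

definition connected_graph :: "'a set \<Rightarrow> 'a set set \<Rightarrow> bool" where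
  "connected_graph V E \<longleftrightarrow>
     (\<forall>u\<in>V. \<forall>v\<in>V. (u, v) \<in> {(x, y). x \<in> V \<and> y \<in> V \<and> {x, y} \<in> E}\<^sup>*)"

text \<open>
  In \<open>connected_graph (V - S) E\<close> the edges meeting \<open>S\<close> play no role, so this is connectedness of the
  graph obtained by deleting the vertices in \<open>S\<close>.
\<close>

definition k_connected :: "nat \<Rightarrow> 'a set \<Rightarrow> 'a set set \<Rightarrow> bool" where
  "k_connected k V E \<longleftrightarrow>
     card V > k \<and> (\<forall>S. S \<subseteq> V \<and> card S < k \<longrightarrow> connected_graph (V - S) E)"

definition whp :: "(nat \<Rightarrow> 'a pmf) \<Rightarrow> (nat \<Rightarrow> 'a \<Rightarrow> bool) \<Rightarrow> bool" where
  "whp X P \<longleftrightarrow> (\<lambda>n. measure_pmf.prob (X n) {x. P n x}) \<longlonglongrightarrow> 1"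

text \<open>
  The law of the multigraph \<open>G\<^sup>*\<^sub>m\<^sub>i\<^sub>n(n,m)\<close>. It is only meaningful for \<open>n \<ge> 2\<close>: for smaller \<open>n\<close> there is
  no vertex \<open>v \<noteq> u\<close>, and \<^const>\<open>pmf_of_set\<close> is unspecified on the empty set.
\<close>

primrec Gmin_star :: "nat \<Rightarrow> nat \<Rightarrow> nat set multiset pmf" where
  "Gmin_star n 0 = return_pmf {#}"
| "Gmin_star n (Suc m) = do {
     M \<leftarrow> Gmin_star n m;
     u \<leftarrow> pmf_of_set (min_vertices n (set_mset M));
     v \<leftarrow> pmf_of_set ({1..n} - {u});
     return_pmf (add_mset {u, v} M)
   }"

text \<open>
  The law of the sequence of the first \<open>m\<close> edges added by the min-degree process. As long as
  \<open>m \<le> n choose 2\<close> the graph is not complete before any of the steps, so a vertex of minimum degree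
  does have a non-neighbour.
\<close>

primrec Gmin_edges :: "nat \<Rightarrow> nat \<Rightarrow> nat set list pmf" where
  "Gmin_edges n 0 = return_pmf []"
| "Gmin_edges n (Suc m) = do {
     es \<leftarrow> Gmin_edges n m;
     u \<leftarrow> pmf_of_set (min_vertices n (set es));
     v \<leftarrow> pmf_of_set ({1..n} - {u} - neighbours (set es) u);
     return_pmf (es @ [{u, v}])
   }"

text \<open>The whole process, run until the graph is complete, and its graph after \<open>m\<close> steps.\<close>

definition Gmin_process :: "nat \<Rightarrow> nat set list pmf" where
  "Gmin_process n = Gmin_edges n (n choose 2)"

definition Gmin_graph :: "nat set list \<Rightarrow> nat \<Rightarrow> nat set set" where
  "Gmin_graph es m = set (take m es)"

text \<open>
  The first \<open>m\<close> at which the minimum degree is at least \<open>k\<close>. For \<open>n > k\<close> such an \<open>m\<close> exists, since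
  the process ends in the complete graph.
\<close>

definition hitting_time :: "nat \<Rightarrow> nat \<Rightarrow> nat set list \<Rightarrow> nat" where
  "hitting_time k n es = (LEAST m. k \<le> min_degree n (Gmin_graph es m))"

text \<open>
  \<open>h\<close> is the constant \<open>h\<^sub>k\<close>: with high probability the hitting time is \<open>(h + o(1)) n\<close>, i.e. hitting
  time divided by \<open>n\<close> tends to \<open>h\<close> in probability.
\<close>

definition is_min_degree_constant :: "nat \<Rightarrow> real \<Rightarrow> bool" where
  "is_min_degree_constant k h \<longleftrightarrow>
     (\<forall>\<epsilon>>0. whp Gmin_process
        (\<lambda>n es. \<bar>real (hitting_time k n es) - h * real n\<bar> \<le> \<epsilon> * real n))"

end

theory Submission
  imports Defs "HOL-Real_Asymp.Real_Asymp"
begin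

text \<open>
  A step of the multigraph process either repeats an edge, with probability depending only on the
  minimum degree, or acts on the underlying simple graph like a step of the min-degree process.
  While the minimum degree is below \<open>k\<close>, repetitions have probability \<open>O(1/n)\<close>, so in both processes
  the minimum degree reaches \<open>k\<close> after \<open>(h + o(1)) n\<close> steps. Below \<open>h\<close> a vertex of small degree
  prevents \<open>k\<close>-connectedness.

  Above \<open>h\<close> it suffices, by monotonicity, to exclude a separation when the minimum degree first
  reaches \<open>k\<close>: disjoint sets \<open>A\<close>, \<open>S\<close>, \<open>B\<close> covering the vertices, with \<open>|A| = a \<le> |B|\<close>,
  \<open>|S| = s < k\<close>, every vertex of \<open>S\<close> adjacent to \<open>A\<close> and no edge between \<open>A\<close> and \<open>B\<close>. An edge
  chosen by \<open>u \<in> A\<close> stays in \<open>A \<union> S\<close> with probability at most \<open>(a + s)/n\<close>, whatever the history,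
  and similarly for \<open>u \<in> B\<close>; each \<open>u \<in> S\<close> gains at most \<open>k\<close> edges of its own choice and costs a
  bounded factor. Hence a product of inverse probabilities over the edges meeting \<open>A\<close> and \<open>B\<close> is a
  supermartingale that starts at \<open>1\<close> and is large on every separation. Counting degrees, more than
  \<open>a + s\<close> edges meet \<open>A\<close> (as \<open>a \<ge> 2\<close> and \<open>k \<ge> 3\<close>) and at least \<open>n - a\<close> meet \<open>B\<close>, and since
  \<open>(n choose a) (a/n)\<^sup>a ((n - a)/n)\<^sup>n\<^sup>-\<^sup>a \<le> 1\<close> the union bound over all separations is \<open>O(1/\<surd>n)\<close>.
\<close>

section \<open>Graphs\<close>

definition all_edges :: "nat \<Rightarrow> nat set set" where
  "all_edges n = {e. e \<subseteq> {1..n} \<and> card e = 2}"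

lemma finite_all_edges: "finite (all_edges n)"
  by (rule finite_subset[of _ "Pow {1..n}"]) (auto simp: all_edges_def)

lemma card_all_edges: "card (all_edges n) = n choose 2"
  unfolding all_edges_def using n_subsets[of "{1..n}" 2] by simp

lemma doubleton_in_all_edges: "{u, v} \<in> all_edges n \<longleftrightarrow> u \<in> {1..n} \<and> v \<in> {1..n} \<and> u \<noteq> v"
  by (auto simp: all_edges_def card_2_iff doubleton_eq_iff)

lemma in_all_edgesE:
  assumes "e \<in> all_edges n"
  obtains u v where "e = {u, v}" "u \<in> {1..n}" "v \<in> {1..n}" "u \<noteq> v"
  using assms unfolding all_edges_def card_2_iff by auto

lemma finite_neighbours:
  assumes "finite E"
  shows "finite (neighbours E u)"
proof (rule inj_on_finite)
  show "inj_on (\<lambda>v. {u, v}) (neighbours E u)"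
    by (auto simp: inj_on_def doubleton_eq_iff)
  show "(\<lambda>v. {u, v}) ` neighbours E u \<subseteq> E"
    by (auto simp: neighbours_def)
qed (fact assms)

lemma neighbours_mono: "E \<subseteq> E' \<Longrightarrow> neighbours E u \<subseteq> neighbours E' u"
  by (auto simp: neighbours_def)

lemma neighbours_subset: "E \<subseteq> all_edges n \<Longrightarrow> neighbours E u \<subseteq> {1..n} - {u}"
  by (auto simp: neighbours_def dest!: subsetD simp: doubleton_in_all_edges)

lemma card_neighbours_mono:
  "E \<subseteq> E' \<Longrightarrow> finite E' \<Longrightarrow> card (neighbours E u) \<le> card (neighbours E' u)"
  by (intro card_mono finite_neighbours neighbours_mono)

lemma neighbours_insert_self:
  "u \<noteq> v \<Longrightarrow> neighbours (insert {u, v} E) u = insert v (neighbours E u)"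
  by (auto simp: neighbours_def doubleton_eq_iff)

lemma insert_edge_absorb: "v \<in> neighbours E u \<Longrightarrow> insert {u, v} E = E"
  by (auto simp: neighbours_def)

lemma min_degree_le: "u \<in> {1..n} \<Longrightarrow> min_degree n E \<le> card (neighbours E u)"
  unfolding min_degree_def by (intro Min_le) auto

lemma le_min_degree_iff:
  "n > 0 \<Longrightarrow> k \<le> min_degree n E \<longleftrightarrow> (\<forall>u\<in>{1..n}. k \<le> card (neighbours E u))"
  unfolding min_degree_def by (subst Min_ge_iff) auto

lemma min_degree_mono:
  assumes "E \<subseteq> E'" "finite E'"
  shows "min_degree n E \<le> min_degree n E'"
proof (cases "n = 0")
  case True
  then show ?thesis by (simp add: min_degree_def)
next
  case False
  have "min_degree n E \<le> card (neighbours E' u)" if "u \<in> {1..n}" for u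
    using min_degree_le[OF that, of E] card_neighbours_mono[OF assms, of u] by linarith
  with False show ?thesis by (simp add: le_min_degree_iff)
qed

lemma finite_min_vertices: "finite (min_vertices n E)"
  by (simp add: min_vertices_def)

lemma min_vertices_nonempty:
  assumes "n > 0"
  shows "min_vertices n E \<noteq> {}"
proof -
  have "min_degree n E \<in> (\<lambda>u. card (neighbours E u)) ` {1..n}"
    unfolding min_degree_def using assms by (intro Min_in) auto
  then show ?thesis by (auto simp: min_vertices_def)
qed

lemma set_pmf_of_min_vertices:
  "n > 0 \<Longrightarrow> set_pmf (pmf_of_set (min_vertices n E)) = min_vertices n E"
  by (simp add: finite_min_vertices min_vertices_nonempty)

section \<open>The two processes as Markov chains on edge sets\<close>

primrec run :: "('a \<Rightarrow> 'a pmf) \<Rightarrow> nat \<Rightarrow> 'a \<Rightarrow> 'a pmf" where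
  "run K 0 x = return_pmf x"
| "run K (Suc m) x = bind_pmf (run K m x) K"

text \<open>\<open>run\<close> appends its last step; inductions over an arbitrary starting state
  need the first step split off instead.\<close>

lemma run_Suc_first: "run K (Suc m) x = bind_pmf (K x) (run K m)"
proof (induction m)
  case 0
  have "run K 0 = return_pmf"
    by (simp add: fun_eq_iff)
  then show ?case
    by (simp add: bind_return_pmf bind_return_pmf')
next
  case (Suc m)
  have "run K (Suc (Suc m)) x = bind_pmf (K x) (\<lambda>y. bind_pmf (run K m y) K)"
    using Suc by (simp add: bind_assoc_pmf)
  also have "(\<lambda>y. bind_pmf (run K m y) K) = run K (Suc m)"
    by (simp add: fun_eq_iff)
  finally show ?case .
qed

text \<open>The supermartingale inequality iterated along the chain. The invariant set
  \<open>I\<close> is there because the one-step inequality will be available only for edge sets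
  inside \<open>all_edges n\<close>.\<close>

lemma nn_integral_run_le:
  assumes "\<And>x. x \<in> I \<Longrightarrow> set_pmf (K x) \<subseteq> I"
    and "\<And>x. x \<in> I \<Longrightarrow> (\<integral>\<^sup>+y. U y \<partial>K x) \<le> U x"
    and "x \<in> I"
  shows "(\<integral>\<^sup>+y. U y \<partial>run K m x) \<le> U x"
  using assms(3)
proof (induction m arbitrary: x)
  case (Suc m)
  have "(\<integral>\<^sup>+y. U y \<partial>run K (Suc m) x) = (\<integral>\<^sup>+z. (\<integral>\<^sup>+y. U y \<partial>run K m z) \<partial>K x)"
    by (subst run_Suc_first) simp
  also have "\<dots> \<le> (\<integral>\<^sup>+z. U z \<partial>K x)"
    using Suc assms(1) by (intro nn_integral_mono_AE) (auto simp: AE_measure_pmf_iff)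
  also have "\<dots> \<le> U x"
    using assms(2) Suc.prems .
  finally show ?case .
qed simp

lemma set_pmf_run_subset:
  assumes "\<And>x. x \<in> I \<Longrightarrow> set_pmf (K x) \<subseteq> I" "x \<in> I"
  shows "set_pmf (run K m x) \<subseteq> I"
  using assms(2) by (induction m) (use assms(1) in auto)

section \<open>One-step kernels and their supports\<close>

definition star_step :: "nat \<Rightarrow> nat set set \<Rightarrow> nat set set pmf" where
  "star_step n E = do {
     u \<leftarrow> pmf_of_set (min_vertices n E);
     v \<leftarrow> pmf_of_set ({1..n} - {u});
     return_pmf (insert {u, v} E)
   }"

definition min_step :: "nat \<Rightarrow> nat set set \<Rightarrow> nat set set pmf" where
  "min_step n E = do {
     u \<leftarrow> pmf_of_set (min_vertices n E);
     v \<leftarrow> pmf_of_set ({1..n} - {u} - neighbours E u);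
     return_pmf (insert {u, v} E)
   }"

text \<open>The laws of \<open>u\<close> and \<open>v\<close> depend on the multigraph only through
  its edge set, so forgetting multiplicities commutes with every step.\<close>

lemma map_set_mset_Gmin_star: "map_pmf set_mset (Gmin_star n m) = run (star_step n) m {}"
proof (induction m)
  case (Suc m)
  have "map_pmf set_mset (Gmin_star n (Suc m))
      = bind_pmf (map_pmf set_mset (Gmin_star n m)) (star_step n)"
    by (simp add: map_bind_pmf bind_map_pmf star_step_def)
  then show ?case by (simp add: Suc)
qed simp

lemma map_set_Gmin_edges: "map_pmf set (Gmin_edges n m) = run (min_step n) m {}"
proof (induction m)
  case (Suc m)
  have "map_pmf set (Gmin_edges n (Suc m))
      = bind_pmf (map_pmf set (Gmin_edges n m)) (min_step n)"
    by (simp add: map_bind_pmf bind_map_pmf min_step_def)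
  then show ?case by (simp add: Suc)
qed simp

lemma card_others: "u \<in> {1..n} \<Longrightarrow> card ({1..n} - {u}) = n - 1"
  by (subst card_Diff_singleton) auto

lemma others_nonempty:
  fixes n u :: nat
  assumes "n \<ge> 2" "u \<in> {1..n}"
  shows "{1..n} - {u} \<noteq> {}"
proof
  assume "{1..n} - {u} = {}"
  with card_others[OF assms(2)] have "n - 1 = 0"
    by (metis card.empty)
  with assms(1) show False by simp
qed

lemma set_star_step:
  assumes "n \<ge> 2" "E \<subseteq> all_edges n" "E' \<in> set_pmf (star_step n E)"
  shows "E \<subseteq> E'" "E' \<subseteq> all_edges n"
proof -
  from assms(3) obtain u v where u: "u \<in> min_vertices n E"
    and v: "v \<in> set_pmf (pmf_of_set ({1..n} - {u}))" and E': "E' = insert {u, v} E"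
    using assms(1) by (auto simp: star_step_def set_pmf_of_min_vertices)
  have u': "u \<in> {1..n}"
    using u by (simp add: min_vertices_def)
  with v others_nonempty[OF assms(1) u'] have "v \<in> {1..n} - {u}"
    by simp
  with u' assms(2) E' show "E \<subseteq> E'" "E' \<subseteq> all_edges n"
    by (auto simp: doubleton_in_all_edges)
qed

lemma set_min_step_superset:
  assumes "E' \<in> set_pmf (min_step n E)" "finite E"
  shows "E \<subseteq> E'" "finite E'"
  using assms by (auto simp: min_step_def)

lemma non_neighbours_nonempty:
  assumes "E \<subseteq> all_edges n" "u \<in> min_vertices n E" "min_degree n E < n - 1"
  shows "{1..n} - {u} - neighbours E u \<noteq> {}"
proof -
  have u: "u \<in> {1..n}" "card (neighbours E u) = min_degree n E"
    using assms(2) by (auto simp: min_vertices_def)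
  show ?thesis
  proof
    assume "{1..n} - {u} - neighbours E u = {}"
    then have "neighbours E u = {1..n} - {u}"
      using neighbours_subset[OF assms(1), of u] by auto
    then show False
      using u assms(3) card_others[OF u(1)] by simp
  qed
qed

lemma set_min_step:
  assumes "n > 0" "E \<subseteq> all_edges n" "min_degree n E < n - 1" "E' \<in> set_pmf (min_step n E)"
  obtains e where "e \<in> all_edges n" "e \<notin> E" "E' = insert e E"
proof -
  from assms(4) obtain u v where u: "u \<in> min_vertices n E"
    and v: "v \<in> set_pmf (pmf_of_set ({1..n} - {u} - neighbours E u))" and E': "E' = insert {u, v} E"
    using assms(1) by (auto simp: min_step_def set_pmf_of_min_vertices)
  have "v \<in> {1..n} - {u} - neighbours E u"
    using v non_neighbours_nonempty[OF assms(2) u assms(3)] by simp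
  moreover have "u \<in> {1..n}"
    using u by (simp add: min_vertices_def)
  ultimately have "{u, v} \<in> all_edges n" "{u, v} \<notin> E"
    by (auto simp: doubleton_in_all_edges neighbours_def)
  with E' that show thesis by blast
qed

lemma min_degree_less:
  assumes "E \<subset> all_edges n"
  shows "min_degree n E < n - 1"
proof -
  obtain e where "e \<in> all_edges n" "e \<notin> E"
    using assms by blast
  then obtain u v where uv: "{u, v} \<notin> E" "u \<in> {1..n}" "v \<in> {1..n}" "u \<noteq> v"
    by (metis in_all_edgesE)
  have "neighbours E u \<subset> {1..n} - {u}"
    using neighbours_subset[of E n u] assms uv by (auto simp: neighbours_def)
  then have "card (neighbours E u) < card ({1..n} - {u})"
    by (intro psubset_card_mono) auto
  then show ?thesis
    using min_degree_le[OF uv(2), of E] card_others[OF uv(2)] by linarith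
qed

lemma min_degree_all_edges:
  assumes "n > 0"
  shows "min_degree n (all_edges n) \<ge> n - 1"
proof -
  have "neighbours (all_edges n) u = {1..n} - {u}" if "u \<in> {1..n}" for u
    using that by (auto simp: neighbours_def doubleton_in_all_edges)
  with assms show ?thesis
    by (simp add: le_min_degree_iff card_others)
qed

section \<open>Comparing the two chains\<close>

lemma divide_ennreal_eq_mult: "c > 0 \<Longrightarrow> x / ennreal c = x * ennreal (1 / c)"
  by (simp add: divide_ennreal_def inverse_ennreal inverse_eq_divide)

text \<open>The chosen \<open>u\<close> has exactly \<open>min_degree n E\<close> neighbours among
  the \<open>n - 1\<close> candidates for \<open>v\<close>. Hitting one of them leaves
  \<open>E\<close> unchanged; otherwise \<open>v\<close> is uniform on the non-neighbours, as in
  \<open>min_step\<close>. All candidates for \<open>u\<close> have the same degree, so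
  \<open>p\<close> does not depend on \<open>u\<close> and comes out of the outer integral.\<close>

lemma nn_integral_star_step:
  fixes F :: "nat set set \<Rightarrow> ennreal"
  assumes "n \<ge> 2" "E \<subseteq> all_edges n" "min_degree n E < n - 1"
  defines "p \<equiv> real (min_degree n E) / real (n - 1)"
  shows "(\<integral>\<^sup>+E'. F E' \<partial>star_step n E) = ennreal p * F E + ennreal (1 - p) * (\<integral>\<^sup>+E'. F E' \<partial>min_step n E)"
proof -
  let ?d = "min_degree n E"
  have inner: "(\<integral>\<^sup>+v. F (insert {u, v} E) \<partial>pmf_of_set ({1..n} - {u})) =
      ennreal p * F E +
      ennreal (1 - p) * (\<integral>\<^sup>+v. F (insert {u, v} E) \<partial>pmf_of_set ({1..n} - {u} - neighbours E u))"
    if u: "u \<in> min_vertices n E" for u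
  proof -
    let ?N = "neighbours E u" and ?M = "{1..n} - {u} - neighbours E u"
    have u': "u \<in> {1..n}" "card ?N = ?d"
      using u by (auto simp: min_vertices_def)
    have sub: "?N \<subseteq> {1..n} - {u}"
      by (rule neighbours_subset[OF assms(2)])
    then have fin: "finite ?N"
      by (rule finite_subset) simp
    have cardM: "card ?M = n - 1 - ?d"
      using card_Diff_subset[OF fin sub] card_others[OF u'(1)] u'(2) by simp
    have "(\<Sum>v\<in>{1..n} - {u}. F (insert {u, v} E)) = (\<Sum>v\<in>?N. F (insert {u, v} E)) + (\<Sum>v\<in>?M. F (insert {u, v} E))"
      using sub by (subst sum.subset_diff[of ?N]) (auto simp: add.commute)
    also have "(\<Sum>v\<in>?N. F (insert {u, v} E)) = ennreal (real ?d) * F E"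
      using u'(2) by (simp add: insert_edge_absorb ennreal_of_nat_eq_real_of_nat)
    finally have sum_split: "(\<Sum>v\<in>{1..n} - {u}. F (insert {u, v} E)) =
      ennreal (real ?d) * F E + (\<Sum>v\<in>?M. F (insert {u, v} E))" .
    have N: "real (n - 1) > 0" and M: "real (n - 1 - ?d) > 0"
      using assms(1,3) by auto
    have "(\<integral>\<^sup>+v. F (insert {u, v} E) \<partial>pmf_of_set ({1..n} - {u}))
        = (\<Sum>v\<in>{1..n} - {u}. F (insert {u, v} E)) / ennreal (real (n - 1))"
      using others_nonempty[OF assms(1) u'(1)]
      by (subst nn_integral_pmf_of_set)
         (simp_all del: One_nat_def add: card_others[OF u'(1)] ennreal_of_nat_eq_real_of_nat)
    also have "\<dots> = ennreal (real ?d) * F E * ennreal (1 / real (n - 1)) +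
        (\<Sum>v\<in>?M. F (insert {u, v} E)) * ennreal (1 / real (n - 1))"
      unfolding sum_split divide_ennreal_eq_mult[OF N] by (rule distrib_right)
    also have "ennreal (real ?d) * F E * ennreal (1 / real (n - 1)) = ennreal p * F E"
    proof -
      have "ennreal p = ennreal (real ?d) * ennreal (1 / real (n - 1))"
        by (subst ennreal_mult[symmetric]) (simp_all add: p_def)
      then show ?thesis by (simp only: mult_ac)
    qed
    also have "(\<Sum>v\<in>?M. F (insert {u, v} E)) * ennreal (1 / real (n - 1)) =
        ennreal (1 - p) * ((\<Sum>v\<in>?M. F (insert {u, v} E)) / ennreal (real (n - 1 - ?d)))"
    proof -
      \<comment> \<open>Uniform on all \<open>n - 1\<close> other vertices, restricted to the
        non-neighbours, is the uniform law there scaled by the probability \<open>1 - p\<close> of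
        avoiding a neighbour.\<close>
      have "1 / real (n - 1) = (1 - p) * (1 / real (n - 1 - ?d))"
        using assms(1,3) by (simp add: p_def field_simps of_nat_diff)
      moreover have "1 - p \<ge> 0"
        using assms(1,3) by (simp add: p_def)
      ultimately have "ennreal (1 / real (n - 1)) = ennreal (1 - p) * ennreal (1 / real (n - 1 - ?d))"
        by (simp only: ennreal_mult[symmetric] zero_le_divide_1_iff of_nat_0_le_iff)
      then show ?thesis
        unfolding divide_ennreal_eq_mult[OF M] by (simp only: mult_ac)
    qed
    also have "(\<Sum>v\<in>?M. F (insert {u, v} E)) / ennreal (real (n - 1 - ?d)) =
        (\<integral>\<^sup>+v. F (insert {u, v} E) \<partial>pmf_of_set ?M)"
      using non_neighbours_nonempty[OF assms(2) u assms(3)]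
      by (subst nn_integral_pmf_of_set)
         (simp_all del: One_nat_def add: cardM ennreal_of_nat_eq_real_of_nat)
    finally show ?thesis .
  qed
  have "(\<integral>\<^sup>+E'. F E' \<partial>star_step n E)
      = (\<integral>\<^sup>+u. (\<integral>\<^sup>+v. F (insert {u, v} E) \<partial>pmf_of_set ({1..n} - {u})) \<partial>pmf_of_set (min_vertices n E))"
    by (simp add: star_step_def)
  also have "\<dots> = (\<integral>\<^sup>+u. ennreal p * F E +
      ennreal (1 - p) * (\<integral>\<^sup>+v. F (insert {u, v} E) \<partial>pmf_of_set ({1..n} - {u} - neighbours E u))
      \<partial>pmf_of_set (min_vertices n E))"
    using assms(1) by (intro nn_integral_cong_AE)
      (simp del: One_nat_def add: AE_measure_pmf_iff set_pmf_of_min_vertices inner)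
  also have "\<dots> = ennreal p * F E + ennreal (1 - p) * (\<integral>\<^sup>+E'. F E' \<partial>min_step n E)"
    by (simp add: min_step_def nn_integral_add nn_integral_cmult)
  finally show ?thesis .
qed

text \<open>\<open>X\<close> is absorbing, so one more step cannot leave it.\<close>

lemma emeasure_run_le_Suc:
  assumes "\<And>x y. x \<in> X \<Longrightarrow> y \<in> set_pmf (K x) \<Longrightarrow> y \<in> X"
  shows "emeasure (run K m x) X \<le> emeasure (run K (Suc m) x) X"
proof -
  have "emeasure (run K m x) X = (\<integral>\<^sup>+y. indicator X y \<partial>run K m x)"
    by simp
  also have "\<dots> \<le> (\<integral>\<^sup>+y. emeasure (K y) X \<partial>run K m x)"
  proof (intro nn_integral_mono)
    fix y
    show "indicator X y \<le> emeasure (K y) X"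
    proof (cases "y \<in> X")
      case True
      have "emeasure (K y) X = 1"
        using assms[OF True] by (intro measure_pmf.emeasure_eq_1_AE) (auto simp: AE_measure_pmf_iff)
      then show ?thesis by (simp add: indicator_def)
    qed simp
  qed
  finally show ?thesis by simp
qed

lemma convex_combination_ennreal:
  "0 \<le> p \<Longrightarrow> p \<le> 1 \<Longrightarrow> ennreal p * a + ennreal (1 - p) * a = a"
  by (simp flip: distrib_right ennreal_plus)

text \<open>The multigraph chain is a lazy version of the simple one, so it can only be behind. In
  the induction a repetition wastes a step, and \<open>up\<close> says that the simple chain does
  not lose by making that step in addition.\<close>

lemma run_star_le_run_min:
  assumes "n > k" "k > 0" "E \<subseteq> all_edges n"
  shows "emeasure (run (star_step n) m E) {E. k \<le> min_degree n E}
       \<le> emeasure (run (min_step n) m E) {E. k \<le> min_degree n E}"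
  using assms(3)
proof (induction m arbitrary: E)
  case (Suc m)
  \<comment> \<open>Once the graph is complete, \<open>v\<close> is drawn from the unspecified
    \<open>pmf_of_set {}\<close> and the chain may leave \<open>all_edges n\<close>. Its edge sets
    still stay finite and grow, which is all that monotonicity of the minimum degree needs.\<close>
  let ?X = "{E. finite E \<and> k \<le> min_degree n E}"
  let ?Y = "{E. k \<le> min_degree n E}"
  have finE: "finite E"
    using Suc.prems finite_all_edges by (rule finite_subset)
  have inX: "emeasure (run (min_step n) j E) ?X = emeasure (run (min_step n) j E) ?Y" for j
  proof (intro emeasure_eq_AE)
    have "set_pmf (run (min_step n) j E) \<subseteq> {E. finite E}"
      using finE by (intro set_pmf_run_subset) (auto dest: set_min_step_superset(2))
    then show "AE x in run (min_step n) j E. (x \<in> ?X) = (x \<in> ?Y)"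
      by (auto simp: AE_measure_pmf_iff)
  qed auto
  have up: "emeasure (run (min_step n) j E) ?Y \<le> emeasure (run (min_step n) (Suc j) E) ?Y" for j
  proof -
    have "E' \<in> ?X" if "E \<in> ?X" "E' \<in> set_pmf (min_step n E)" for E E'
      using set_min_step_superset[OF that(2)] that(1) min_degree_mono[of E E' n] by auto
    then have "emeasure (run (min_step n) j E) ?X \<le> emeasure (run (min_step n) (Suc j) E) ?X"
      by (rule emeasure_run_le_Suc)
    then show ?thesis by (simp only: inX)
  qed
  show ?case
  proof (cases "k \<le> min_degree n E")
    case True
    have "1 = emeasure (run (min_step n) 0 E) ?Y"
      using True by simp
    also have "\<dots> \<le> emeasure (run (min_step n) (Suc m) E) ?Y"
      by (rule lift_Suc_mono_le[of "\<lambda>j. emeasure (run (min_step n) j E) ?Y", OF up]) simp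
    finally show ?thesis
      by (rule order_trans[OF measure_pmf.emeasure_le_1])
  next
    case False
    define p where "p = real (min_degree n E) / real (n - 1)"
    have d: "min_degree n E < n - 1" and n: "n \<ge> 2"
      using False assms by auto
    have p: "0 \<le> p" "p \<le> 1"
      using d by (auto simp: p_def)
    have "emeasure (run (star_step n) (Suc m) E) ?Y
        = (\<integral>\<^sup>+E'. emeasure (run (star_step n) m E') ?Y \<partial>star_step n E)"
      by (subst run_Suc_first) simp
    also have "\<dots> \<le> (\<integral>\<^sup>+E'. emeasure (run (min_step n) m E') ?Y \<partial>star_step n E)"
      using Suc set_star_step(2)[OF n Suc.prems]
      by (intro nn_integral_mono_AE) (auto simp: AE_measure_pmf_iff)
    also have "\<dots> = ennreal p * emeasure (run (min_step n) m E) ?Y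
        + ennreal (1 - p) * (\<integral>\<^sup>+E'. emeasure (run (min_step n) m E') ?Y \<partial>min_step n E)"
      unfolding p_def by (rule nn_integral_star_step[OF n Suc.prems d])
    also have "(\<integral>\<^sup>+E'. emeasure (run (min_step n) m E') ?Y \<partial>min_step n E)
        = emeasure (run (min_step n) (Suc m) E) ?Y"
      by (subst run_Suc_first) simp
    also have "ennreal p * emeasure (run (min_step n) m E) ?Y
        + ennreal (1 - p) * emeasure (run (min_step n) (Suc m) E) ?Y
      \<le> ennreal p * emeasure (run (min_step n) (Suc m) E) ?Y
        + ennreal (1 - p) * emeasure (run (min_step n) (Suc m) E) ?Y"
      using up by (intro add_mono mult_left_mono) auto
    also have "\<dots> = emeasure (run (min_step n) (Suc m) E) ?Y"
      using p by (rule convex_combination_ennreal)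
    finally show ?thesis .
  qed
qed simp

text \<open>Below minimum degree \<open>k\<close> a step repeats an edge with probability at most
  \<open>q = (k - 1)/(n - 1)\<close>; by Markov's inequality for \<open>2\<^sup>R\<close>, more than \<open>m - j\<close> of \<open>m\<close> steps do so with
  probability at most \<open>2\<^sup>j\<^sup>-\<^sup>m (1 + q)\<^sup>m\<close>.\<close>

lemma run_star_le_run_min_add:
  assumes "n > k" "k > 0" "E \<subseteq> all_edges n"
  shows "emeasure (run (star_step n) m E) {E. min_degree n E < k}
       \<le> emeasure (run (min_step n) j E) {E. min_degree n E < k}
         + ennreal (2 ^ j * ((1 + real (k - 1) / real (n - 1)) / 2) ^ m)"
  using assms(3)
proof (induction m arbitrary: E j)
  case 0
  have "(1 :: real) \<le> 2 ^ j" by simp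
  then have "1 \<le> ennreal (2 ^ j)"
    using ennreal_leI[of 1 "2 ^ j"] by simp
  then show ?case
    using measure_pmf.emeasure_le_1[of "return_pmf E" "{E. min_degree n E < k}"]
    by (simp add: add_increasing order_trans)
next
  case (Suc m)
  let ?Y = "{E. min_degree n E < k}"
  define q where "q = real (k - 1) / real (n - 1)"
  define c where "c = (\<lambda>m j. 2 ^ j * ((1 + q) / 2) ^ m :: real)"
  have q: "q \<ge> 0" by (simp add: q_def)
  have c0: "c m j \<ge> 0" for m j using q by (simp add: c_def)
  have IH: "emeasure (run (star_step n) m E) ?Y \<le> emeasure (run (min_step n) j E) ?Y + ennreal (c m j)"
    if "E \<subseteq> all_edges n" for E j
    using Suc.IH[OF that, of j] by (simp add: c_def q_def)
  have n: "n \<ge> 2" using assms by simp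
  have first: "emeasure (run (star_step n) (Suc m) E) ?Y
        = (\<integral>\<^sup>+E'. emeasure (run (star_step n) m E') ?Y \<partial>star_step n E)"
    by (subst run_Suc_first) simp
  have "emeasure (run (star_step n) (Suc m) E) ?Y \<le> emeasure (run (min_step n) j E) ?Y + ennreal (c (Suc m) j)"
  proof (cases "min_degree n E < k")
    case False
    have "set_pmf (run (star_step n) (Suc m) E) \<subseteq> {E. E \<subseteq> all_edges n \<and> k \<le> min_degree n E}"
    proof (rule set_pmf_run_subset)
      show "E \<in> {E. E \<subseteq> all_edges n \<and> k \<le> min_degree n E}"
        using False Suc.prems by simp
      fix E assume E: "E \<in> {E. E \<subseteq> all_edges n \<and> k \<le> min_degree n E}"
      show "set_pmf (star_step n E) \<subseteq> {E. E \<subseteq> all_edges n \<and> k \<le> min_degree n E}"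
      proof
        fix E' assume "E' \<in> set_pmf (star_step n E)"
        from set_star_step[OF n _ this] E min_degree_mono[of E E' n] finite_all_edges
        show "E' \<in> {E. E \<subseteq> all_edges n \<and> k \<le> min_degree n E}"
          by (auto dest: finite_subset)
      qed
    qed
    then have "emeasure (run (star_step n) (Suc m) E) ?Y = 0"
      by (auto simp: measure_pmf.emeasure_eq_measure measure_pmf_zero_iff)
    then show ?thesis by simp
  next
    case True
    define p where "p = real (min_degree n E) / real (n - 1)"
    have d: "min_degree n E < n - 1"
      using True assms by auto
    have p: "0 \<le> p" "p \<le> 1"
      using d by (auto simp: p_def)
    have pq: "p \<le> q"
      unfolding p_def q_def using True by (intro divide_right_mono) auto
    show ?thesis
    \<comment> \<open>For \<open>j = 0\<close> the simple chain has not moved and the right-hand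
      side is at least \<open>1\<close>. Otherwise a repetition keeps \<open>j\<close>, and an
      effective step lowers it to \<open>i\<close>.\<close>
    proof (cases j)
      case 0
      have "emeasure (run (min_step n) j E) ?Y = 1"
        using True 0 by simp
      then show ?thesis
        using measure_pmf.emeasure_le_1[of "run (star_step n) (Suc m) E" ?Y]
        by (simp add: add_increasing2)
    next
      case (Suc i)
      let ?f = "emeasure (run (min_step n) j E) ?Y"
      have "emeasure (run (star_step n) (Suc m) E) ?Y = ennreal p * emeasure (run (star_step n) m E) ?Y
        + ennreal (1 - p) * (\<integral>\<^sup>+E'. emeasure (run (star_step n) m E') ?Y \<partial>min_step n E)"
        unfolding first p_def by (rule nn_integral_star_step[OF n \<open>E \<subseteq> all_edges n\<close> d])
      also have "\<dots> \<le> ennreal p * (?f + ennreal (c m j))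
        +ennreal (1 - p) * (\<integral>\<^sup>+E'. emeasure (run (min_step n) i E') ?Y + ennreal (c m i) \<partial>min_step n E)"
      proof (intro add_mono mult_left_mono IH nn_integral_mono_AE)
        have "E' \<subseteq> all_edges n" if "E' \<in> set_pmf (min_step n E)" for E'
          using set_min_step[OF _ \<open>E \<subseteq> all_edges n\<close> d that] n \<open>E \<subseteq> all_edges n\<close> by auto
        then show "AE E' in min_step n E. emeasure (run (star_step n) m E') ?Y
            \<le> emeasure (run (min_step n) i E') ?Y + ennreal (c m i)"
          by (simp add: AE_measure_pmf_iff IH)
      qed (use \<open>E \<subseteq> all_edges n\<close> in auto)
      also have "(\<integral>\<^sup>+E'. emeasure (run (min_step n) i E') ?Y + ennreal (c m i) \<partial>min_step n E)
          = ?f + ennreal (c m i)"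
        unfolding Suc by (subst run_Suc_first) (simp add: nn_integral_add)
      also have "ennreal p * (?f + ennreal (c m j)) + ennreal (1 - p) * (?f + ennreal (c m i))
          = (ennreal p * ?f + ennreal (1 - p) * ?f) + ennreal (p * c m j + (1 - p) * c m i)"
        using p c0 by (simp add: distrib_left ennreal_plus ennreal_mult add_ac)
      also have "ennreal p * ?f + ennreal (1 - p) * ?f = ?f"
        using p by (rule convex_combination_ennreal)
      also have "?f + ennreal (p * c m j + (1 - p) * c m i) \<le> ?f + ennreal (c (Suc m) j)"
      proof (intro add_left_mono ennreal_leI)
        \<comment> \<open>As \<open>j = Suc i\<close>, \<open>c m j\<close> is twice
          \<open>c m i\<close>, so averaging over the two outcomes gives the factor
          \<open>2 * p + (1 - p) = 1 + p\<close>.\<close>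
        have "p * c m j + (1 - p) * c m i = c m i * (1 + p)"
          by (simp add: c_def Suc algebra_simps)
        also have "\<dots> \<le> c m i * (1 + q)"
          using pq c0 by (intro mult_left_mono) auto
        also have "\<dots> = c (Suc m) j"
          by (simp add: c_def Suc)
        finally show "p * c m j + (1 - p) * c m i \<le> c (Suc m) j" .
      qed
      finally show ?thesis .
    qed
  qed
  then show ?case by (simp add: c_def q_def)
qed

section \<open>The potential of a separation\<close>

definition touching :: "'a set set \<Rightarrow> 'a set \<Rightarrow> 'a set set" where
  "touching E X = {e \<in> E. e \<inter> X \<noteq> {}}"

definition separated :: "'a set set \<Rightarrow> 'a set \<Rightarrow> 'a set \<Rightarrow> bool" where
  "separated E A B \<longleftrightarrow> (\<forall>e\<in>E. e \<inter> A = {} \<or> e \<inter> B = {})"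

text \<open>An edge chosen by \<open>u \<in> S\<close> multiplies the first two factors by a little over \<open>2\<close> on average
  (about \<open>1\<close> each from \<open>v \<in> A\<close> and \<open>v \<in> B\<close>), which the factor \<open>1/4\<close> per new neighbour absorbs.\<close>

definition potential :: "nat \<Rightarrow> nat \<Rightarrow> nat set \<Rightarrow> nat set \<Rightarrow> nat set \<Rightarrow> nat set set \<Rightarrow> real" where
  "potential n k A B S E = (if separated E A B then
       (real n / real (card A + card S)) ^ card (touching E A)
     * (real n / real (card B + card S)) ^ card (touching E B)
     * (1 / 4) ^ (\<Sum>w\<in>S. min k (card (neighbours E w)))
   else 0)"

lemma potential_nonneg: "potential n k A B S E \<ge> 0"
  by (simp add: potential_def)

lemma potential_commute: "potential n k A B S E = potential n k B A S E"
  by (auto simp: potential_def separated_def mult_ac)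

lemma potential_empty: "potential n k A B S {} = 1"
  by (simp add: potential_def separated_def touching_def neighbours_def)

lemma card_touching_insert_le:
  assumes "finite E"
  shows "card (touching (insert e E) X) \<le> card (touching E X) + of_bool (e \<inter> X \<noteq> {})"
proof -
  have "touching (insert e E) X = (if e \<inter> X \<noteq> {} then insert e (touching E X) else touching E X)"
    by (auto simp: touching_def)
  then show ?thesis
    using assms by (auto simp: touching_def card_insert_if)
qed

text \<open>Count ordered pairs \<open>(x, y)\<close> for which \<open>{x, y}\<close> is an edge
  touching \<open>X\<close>; every edge has at most two orientations. Pairs starting in
  \<open>X\<close> give the degree sum. Edges leaving \<open>X\<close>, read backwards, start
  outside \<open>X\<close> and are therefore counted in addition.\<close>

lemma two_card_touching_ge:
  assumes "E \<subseteq> all_edges n" "X \<subseteq> {1..n}"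
  shows "(\<Sum>x\<in>X. card (neighbours E x)) + card {(x, w). x \<in> X \<and> w \<notin> X \<and> {x, w} \<in> E}
       \<le> 2 * card (touching E X)"
proof -
  let ?R = "{(x, w). x \<in> X \<and> w \<notin> X \<and> {x, w} \<in> E}"
  let ?P = "Sigma X (neighbours E)"
  let ?Q = "\<Union>e\<in>touching E X. {(x, y). {x, y} = e}"
  have fE: "finite E" and fX: "finite X"
    using assms finite_all_edges by (auto intro: finite_subset)
  have fT: "finite (touching E X)"
    using fE by (simp add: touching_def)
  have two: "finite {(x, y). {x, y} = e} \<and> card {(x, y). {x, y} = e} \<le> 2" if e: "e \<in> touching E X" for e
  proof -
    obtain p q where "e = {p, q}"
      using e assms(1) by (auto simp: touching_def elim!: in_all_edgesE[OF subsetD])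
    then have sub: "{(x, y). {x, y} = e} \<subseteq> {(p, q), (q, p)}"
      by (auto simp: doubleton_eq_iff)
    have "card {(p, q), (q, p)} \<le> 2"
      using card_insert_le_m1[of 2 "{(q, p)}" "(p, q)"] by simp
    moreover have "card {(x, y). {x, y} = e} \<le> card {(p, q), (q, p)}"
      by (rule card_mono[OF _ sub]) simp
    moreover have "finite {(x, y). {x, y} = e}"
      by (rule finite_subset[OF sub]) simp
    ultimately show ?thesis
      by linarith
  qed
  have fQ: "finite ?Q"
    using fT two by blast
  have "card ?Q \<le> (\<Sum>e\<in>touching E X. card {(x, y). {x, y} = e})"
    by (rule card_UN_le[OF fT])
  also have "\<dots> \<le> (\<Sum>e\<in>touching E X. 2)"
    using two by (intro sum_mono) auto
  finally have "card ?Q \<le> 2 * card (touching E X)"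
    by simp
  have sub: "?P \<union> prod.swap ` ?R \<subseteq> ?Q"
    by (auto simp: touching_def neighbours_def insert_commute)
  have "card ?P + card ?R = card ?P + card (prod.swap ` ?R)"
    by (simp add: card_image)
  also have "\<dots> = card (?P \<union> prod.swap ` ?R)"
    using finite_subset[OF sub fQ] by (intro card_Un_disjoint[symmetric]) auto
  also have "\<dots> \<le> card ?Q"
    by (rule card_mono[OF fQ sub])
  finally have "card ?P + card ?R \<le> card ?Q" .
  moreover have "card ?P = (\<Sum>x\<in>X. card (neighbours E x))"
    using fX fE by (intro card_SigmaI) (auto intro: finite_neighbours)
  ultimately show ?thesis
    using \<open>card ?Q \<le> 2 * card (touching E X)\<close> by linarith
qed

section \<open>Supermartingale property of the potential\<close>

locale separation =
  fixes n k :: nat and A B S :: "nat set"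
  assumes cover: "A \<union> B \<union> S = {1..n}"
    and disjoint: "A \<inter> B = {}" "A \<inter> S = {}" "B \<inter> S = {}"
    and nonempty: "A \<noteq> {}" "B \<noteq> {}"
    and card_S: "card S < k"
    and n_large: "4 * k \<le> n" "k \<ge> 2"
begin

lemma swap: "separation n k B A S"
  using cover disjoint nonempty card_S n_large by unfold_locales auto

lemma finite_parts: "finite A" "finite B" "finite S"
  by (rule finite_subset[of _ "{1..n}"], use cover in blast, simp)+

lemma card_sum: "card A + card B + card S = n"
proof -
  have "n = card (A \<union> B \<union> S)"
    by (simp add: cover)
  also have "\<dots> = card (A \<union> B) + card S"
    using disjoint finite_parts by (intro card_Un_disjoint) auto
  also have "card (A \<union> B) = card A + card B"
    using disjoint finite_parts by (intro card_Un_disjoint) auto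
  finally show ?thesis by simp
qed

lemma card_pos: "card A > 0" "card B > 0"
  using nonempty finite_parts by (auto simp: card_gt_0_iff)

lemma ratio_ge_1: "real n / real (card A + card S) \<ge> 1"
  using card_sum card_pos by simp

text \<open>An edge joining \<open>A\<close> to \<open>B\<close> makes the potential vanish.
  Otherwise each factor changes by at most the stated amount; this is only an inequality because
  \<open>e\<close> may be present already, and the ratios are at least \<open>1\<close>.\<close>

lemma potential_insert_le:
  assumes "finite E" "separated E A B"
    and "(\<Sum>w\<in>S. min k (card (neighbours E w))) + j \<le> (\<Sum>w\<in>S. min k (card (neighbours (insert e E) w)))"
  shows "potential n k A B S (insert e E) \<le>
     (if e \<inter> A \<noteq> {} then real n / real (card A + card S) else 1)
   * (if e \<inter> B \<noteq> {} then real n / real (card B + card S) else 1)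
   * (1 / 4) ^ j * potential n k A B S E"
proof -
  interpret sw: separation n k B A S by (rule swap)
  have pow: "x ^ card (touching (insert e E) X) \<le> (if e \<inter> X \<noteq> {} then x else 1) * x ^ card (touching E X)"
    if "x \<ge> 1" for x :: real and X
  proof -
    have "x ^ card (touching (insert e E) X) \<le> x ^ (card (touching E X) + of_bool (e \<inter> X \<noteq> {}))"
      using that card_touching_insert_le[OF assms(1)] by (intro power_increasing) auto
    then show ?thesis by (cases "e \<inter> X = {}") simp_all
  qed
  have quarter: "(1 / 4 :: real) ^ (\<Sum>w\<in>S. min k (card (neighbours (insert e E) w)))
      \<le> (1 / 4) ^ j * (1 / 4) ^ (\<Sum>w\<in>S. min k (card (neighbours E w)))"
    unfolding power_add[symmetric] using assms(3) by (intro power_decreasing) auto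
  show ?thesis
  proof (cases "separated (insert e E) A B")
    case True
    then have "potential n k A B S (insert e E) \<le>
        ((if e \<inter> A \<noteq> {} then real n / real (card A + card S) else 1) * (real n / real (card A + card S)) ^ card (touching E A))
      * ((if e \<inter> B \<noteq> {} then real n / real (card B + card S) else 1) * (real n / real (card B + card S)) ^ card (touching E B))
      * ((1 / 4) ^ j * (1 / 4) ^ (\<Sum>w\<in>S. min k (card (neighbours E w))))"
      unfolding potential_def
      by (simp only: if_True) (intro mult_mono pow quarter ratio_ge_1 sw.ratio_ge_1; simp)
    also have "\<dots> = (if e \<inter> A \<noteq> {} then real n / real (card A + card S) else 1)
       * (if e \<inter> B \<noteq> {} then real n / real (card B + card S) else 1)
       * (1 / 4) ^ j * potential n k A B S E"
      using assms(2) unfolding potential_def by (simp only: if_True mult_ac)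
    finally show ?thesis .
  next
    case False
    then have "potential n k A B S (insert e E) = 0"
      by (simp add: potential_def)
    then show ?thesis
      using potential_nonneg[of n k A B S E] by auto
  qed
qed

lemma capped_degrees_mono:
  assumes "finite E"
  shows "(\<Sum>w\<in>S. min k (card (neighbours E w))) \<le> (\<Sum>w\<in>S. min k (card (neighbours (insert e E) w)))"
  using assms by (intro sum_mono min.mono card_neighbours_mono) auto

text \<open>The degree of \<open>u\<close> is below the cap \<open>k\<close>, so its new neighbour
  raises the capped sum, while no other term falls.\<close>

lemma capped_degrees_Suc:
  assumes "finite E" "u \<in> S" "card (neighbours E u) < k" "v \<notin> neighbours E u" "u \<noteq> v"
  shows "(\<Sum>w\<in>S. min k (card (neighbours E w))) + 1 \<le> (\<Sum>w\<in>S. min k (card (neighbours (insert {u, v} E) w)))"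
proof -
  have "(\<Sum>w\<in>S. min k (card (neighbours E w))) < (\<Sum>w\<in>S. min k (card (neighbours (insert {u, v} E) w)))"
  proof (rule sum_strict_mono_ex1)
    show "\<forall>w\<in>S. min k (card (neighbours E w)) \<le> min k (card (neighbours (insert {u, v} E) w))"
      using assms(1) by (intro ballI min.mono card_neighbours_mono) auto
    have "card (neighbours (insert {u, v} E) u) = Suc (card (neighbours E u))"
      using assms by (simp add: neighbours_insert_self finite_neighbours)
    then show "\<exists>w\<in>S. min k (card (neighbours E w)) < min k (card (neighbours (insert {u, v} E) w))"
      using assms(2,3) by (intro bexI[of _ u]) auto
  qed (rule finite_parts)
  then show ?thesis by simp
qed

text \<open>Let \<open>a\<close> and \<open>s\<close> be the sizes of \<open>A\<close> and
  \<open>S\<close>. A choice of \<open>v\<close> in \<open>B\<close> kills the potential; each of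
  the other \<open>a + s - 1\<close> choices costs a factor of at most \<open>n / (a + s)\<close>.
  In total this is \<open>n - n / (a + s)\<close>, at most \<open>n - 1\<close>.\<close>

lemma sum_potential_le_side:
  assumes E: "finite E" "separated E A B" and u: "u \<in> A"
  shows "(\<Sum>v\<in>{1..n} - {u}. potential n k A B S (insert {u, v} E)) \<le> real (n - 1) * potential n k A B S E"
proof -
  let ?x = "real n / real (card A + card S)" and ?\<Phi> = "potential n k A B S"
  have le: "?\<Phi> (insert {u, v} E) \<le> of_bool (v \<in> A \<union> S) * (?x * ?\<Phi> E)" if v: "v \<in> {1..n} - {u}" for v
  proof (cases "v \<in> B")
    case True
    with u have "\<not> separated (insert {u, v} E) A B"
      by (auto simp: separated_def)
    then show ?thesis
      using potential_nonneg[of n k A B S E] by (simp add: potential_def)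
  next
    case False
    then have "v \<in> A \<union> S" using v cover by blast
    have "{u, v} \<inter> B = {}" "{u, v} \<inter> A \<noteq> {}"
      using False u disjoint by auto
    then have "?\<Phi> (insert {u, v} E) \<le> ?x * 1 * (1 / 4) ^ 0 * ?\<Phi> E"
      using potential_insert_le[OF E, of 0 "{u, v}"] capped_degrees_mono[OF E(1), of "{u, v}"]
      by (simp only: simp_thms if_True if_False add_0_right)
    with \<open>v \<in> A \<union> S\<close> show ?thesis
      by (simp only: of_bool_eq power_0 mult_1_left mult_1_right)
  qed
  have "(\<Sum>v\<in>{1..n} - {u}. ?\<Phi> (insert {u, v} E))
      \<le> (\<Sum>v\<in>{1..n} - {u}. of_bool (v \<in> A \<union> S) * (?x * ?\<Phi> E))"
    by (intro sum_mono le)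
  also have "\<dots> = real (card (({1..n} - {u}) \<inter> {v. v \<in> A \<union> S})) * (?x * ?\<Phi> E)"
    unfolding sum_distrib_right[symmetric] by (subst sum_of_bool_eq) simp_all
  also have "({1..n} - {u}) \<inter> {v. v \<in> A \<union> S} = A \<union> S - {u}"
    using cover by auto
  also have "real (card (A \<union> S - {u})) = real (card A + card S) - 1"
  proof -
    have "card (A \<union> S) = card A + card S"
      using disjoint finite_parts by (intro card_Un_disjoint) auto
    then show ?thesis
      using u card_pos by (subst card_Diff_singleton) auto
  qed
  also have "(real (card A + card S) - 1) * (?x * ?\<Phi> E) = (real n - ?x) * ?\<Phi> E"
    using card_pos by (simp add: field_simps)
  also have "\<dots> \<le> real (n - 1) * ?\<Phi> E"
    using ratio_ge_1 n_large by (intro mult_right_mono potential_nonneg) (simp add: of_nat_diff)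
  finally show ?thesis .
qed

text \<open>Fewer than \<open>k\<close> choices repeat an edge, at factor \<open>1\<close>. A new
  neighbour earns \<open>1 / 4\<close> through the degree of \<open>u\<close>, and the ratios summed
  over \<open>A\<close> and over \<open>B\<close> give at most \<open>n\<close> each. The total is
  at most \<open>(k - 1) + (2 * n + k) / 4\<close>, hence at most \<open>n - 1\<close> because
  \<open>4 * k \<le> n\<close>.\<close>

lemma sum_potential_le_cut:
  assumes E: "finite E" "separated E A B" and u: "u \<in> S" "card (neighbours E u) < k"
  shows "(\<Sum>v\<in>{1..n} - {u}. potential n k A B S (insert {u, v} E)) \<le> real (n - 1) * potential n k A B S E"
proof -
  interpret sw: separation n k B A S by (rule swap)
  let ?x = "real n / real (card A + card S)" and ?y = "real n / real (card B + card S)"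
  let ?\<Phi> = "potential n k A B S"
  let ?w = "\<lambda>v. of_bool (v \<in> neighbours E u) +
      (?x * of_bool (v \<in> A) + ?y * of_bool (v \<in> B) + of_bool (v \<in> S)) / 4"
  have "?\<Phi> (insert {u, v} E) \<le> ?w v * ?\<Phi> E" if v: "v \<in> {1..n} - {u}" for v
  proof (cases "v \<in> neighbours E u")
    case True
    then have "?\<Phi> (insert {u, v} E) = 1 * ?\<Phi> E"
      by (simp add: insert_edge_absorb)
    also have "\<dots> \<le> ?w v * ?\<Phi> E"
      using True by (intro mult_right_mono potential_nonneg) auto
    finally show ?thesis .
  next
    case False
    have eq: "{u, v} \<inter> A \<noteq> {} \<longleftrightarrow> v \<in> A" "{u, v} \<inter> B \<noteq> {} \<longleftrightarrow> v \<in> B"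
      using u(1) disjoint by auto
    have "?\<Phi> (insert {u, v} E) \<le> (if v \<in> A then ?x else 1) * (if v \<in> B then ?y else 1) * (1 / 4) ^ 1 * ?\<Phi> E"
      using potential_insert_le[OF E capped_degrees_Suc[OF E(1) u False]] v unfolding eq by blast
    also have "(if v \<in> A then ?x else 1) * (if v \<in> B then ?y else 1) * (1 / 4) ^ 1 = ?w v"
      using v False cover disjoint by auto
    finally show ?thesis .
  qed
  then have "(\<Sum>v\<in>{1..n} - {u}. ?\<Phi> (insert {u, v} E)) \<le> (\<Sum>v\<in>{1..n} - {u}. ?w v * ?\<Phi> E)"
    by (rule sum_mono)
  also have "\<dots> \<le> (\<Sum>v\<in>{1..n}. ?w v * ?\<Phi> E)"
    by (intro sum_mono2 mult_nonneg_nonneg potential_nonneg) auto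
  also have "\<dots> = (\<Sum>v\<in>{1..n}. ?w v) * ?\<Phi> E"
    by (rule sum_distrib_right[symmetric])
  also have "(\<Sum>v\<in>{1..n}. ?w v) = real (card ({1..n} \<inter> {v. v \<in> neighbours E u})) +
      (?x * real (card ({1..n} \<inter> {v. v \<in> A})) + ?y * real (card ({1..n} \<inter> {v. v \<in> B}))
       + real (card ({1..n} \<inter> {v. v \<in> S}))) / 4"
    by (simp only: sum.distrib sum_divide_distrib[symmetric] sum_distrib_left[symmetric]
          sum_of_bool_eq finite_atLeastAtMost)
  also have "\<dots> * ?\<Phi> E \<le> real (n - 1) * ?\<Phi> E"
  proof (intro mult_right_mono potential_nonneg)
    have "{1..n} \<inter> {v. v \<in> A} = A" "{1..n} \<inter> {v. v \<in> B} = B" "{1..n} \<inter> {v. v \<in> S} = S"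
      using cover by auto
    moreover have "real (card ({1..n} \<inter> {v. v \<in> neighbours E u})) \<le> real k - 1"
    proof -
      have "card ({1..n} \<inter> {v. v \<in> neighbours E u}) \<le> card (neighbours E u)"
        using E(1) by (intro card_mono finite_neighbours) auto
      with u(2) show ?thesis by linarith
    qed
    moreover have "real (card S) \<le> real k" "4 * real k \<le> real n" "real (n - 1) = real n - 1"
      using card_S n_large by linarith+
    moreover have "?x * real (card A) \<le> n" "?y * real (card B) \<le> n"
      using card_pos by (auto simp: field_simps)
    moreover have "c + (p + q + s) / 4 \<le> m"
      if "c \<le> real k - 1" "p \<le> real n" "q \<le> real n" "s \<le> real k" "m = real n - 1"
        "4 * real k \<le> real n" for c p q s m :: real
      using that unfolding add_divide_distrib by linarith
    ultimately show "real (card ({1..n} \<inter> {v. v \<in> neighbours E u})) +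
      (?x * real (card ({1..n} \<inter> {v. v \<in> A})) + ?y * real (card ({1..n} \<inter> {v. v \<in> B}))
       + real (card ({1..n} \<inter> {v. v \<in> S}))) / 4 \<le> real (n - 1)"
      by (simp only:)
  qed
  finally show ?thesis .
qed

lemma sum_potential_le:
  assumes E: "finite E" and u: "u \<in> {1..n}" "card (neighbours E u) < k"
  shows "(\<Sum>v\<in>{1..n} - {u}. potential n k A B S (insert {u, v} E)) \<le> real (n - 1) * potential n k A B S E"
proof (cases "separated E A B")
  case True
  interpret sw: separation n k B A S by (rule swap)
  have "separated E B A"
    using True by (auto simp: separated_def)
  with sw.sum_potential_le_side[OF E this] show ?thesis
    using sum_potential_le_side[OF E True] sum_potential_le_cut[OF E True _ u(2)] u(1) cover
    unfolding potential_commute[of n k B A] by blast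
next
  case False
  \<comment> \<open>A broken separation stays broken, so both sides are zero.\<close>
  then have "\<not> separated (insert e E) A B" for e
    by (auto simp: separated_def)
  then show ?thesis
    by (simp add: potential_def)
qed

text \<open>The vertex drawn has degree \<open>min_degree n E\<close>, so the hypothesis supplies
  the degree bound of \<open>sum_potential_le\<close> for every possible \<open>u\<close>.\<close>

lemma nn_integral_potential_le:
  assumes "finite E" "min_degree n E < k"
  shows "(\<integral>\<^sup>+E'. potential n k A B S E' \<partial>star_step n E) \<le> potential n k A B S E"
proof -
  have n: "n \<ge> 2" using n_large by simp
  have "(\<integral>\<^sup>+E'. potential n k A B S E' \<partial>star_step n E) =
      (\<integral>\<^sup>+u. (\<integral>\<^sup>+v. potential n k A B S (insert {u, v} E) \<partial>pmf_of_set ({1..n} - {u})) \<partial>pmf_of_set (min_vertices n E))"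
    by (simp add: star_step_def)
  also have "\<dots> \<le> (\<integral>\<^sup>+u. potential n k A B S E \<partial>pmf_of_set (min_vertices n E))"
  proof (intro nn_integral_mono_AE, unfold AE_measure_pmf_iff, intro ballI)
    fix u assume "u \<in> set_pmf (pmf_of_set (min_vertices n E))"
    then have "u \<in> min_vertices n E"
      using n by (simp add: set_pmf_of_min_vertices)
    then have u: "u \<in> {1..n}" "card (neighbours E u) < k"
      using assms(2) by (auto simp: min_vertices_def)
    have pos: "real (n - 1) > 0" using n by simp
    have "(\<integral>\<^sup>+v. potential n k A B S (insert {u, v} E) \<partial>pmf_of_set ({1..n} - {u}))
        = ennreal (\<Sum>v\<in>{1..n} - {u}. potential n k A B S (insert {u, v} E)) / ennreal (real (n - 1))"
      using others_nonempty[OF n u(1)]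
      by (subst nn_integral_pmf_of_set)
         (simp_all del: One_nat_def add: card_others[OF u(1)] ennreal_of_nat_eq_real_of_nat
            sum_ennreal potential_nonneg)
    also have "\<dots> = ennreal ((\<Sum>v\<in>{1..n} - {u}. potential n k A B S (insert {u, v} E)) / real (n - 1))"
      using pos by (intro divide_ennreal sum_nonneg potential_nonneg)
    also have "\<dots> \<le> ennreal (potential n k A B S E)"
      using sum_potential_le[OF assms(1) u] pos by (intro ennreal_leI) (simp add: divide_le_eq mult.commute)
    finally show "(\<integral>\<^sup>+v. potential n k A B S (insert {u, v} E) \<partial>pmf_of_set ({1..n} - {u}))
        \<le> ennreal (potential n k A B S E)" .
  qed
  also have "\<dots> = potential n k A B S E"
    by simp
  finally show ?thesis .
qed

end

section \<open>Union bound over all separations\<close>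

lemma k_connected_mono:
  assumes "E \<subseteq> E'" "k_connected k V E"
  shows "k_connected k V E'"
proof -
  have "connected_graph W E'" if "connected_graph W E" for W
  proof -
    have "{(x, y). x \<in> W \<and> y \<in> W \<and> {x, y} \<in> E}\<^sup>* \<subseteq> {(x, y). x \<in> W \<and> y \<in> W \<and> {x, y} \<in> E'}\<^sup>*"
      using assms(1) by (intro rtrancl_mono) auto
    with that show ?thesis
      unfolding connected_graph_def by blast
  qed
  with assms(2) show ?thesis
    by (simp add: k_connected_def)
qed

text \<open>The third part is the complement of \<open>A\<close> and \<open>S\<close>. One-element
  sets \<open>A\<close> are left out: at minimum degree \<open>k\<close>, the at least
  \<open>k\<close> neighbours of the vertex would all have to lie in the smaller set
  \<open>S\<close>.\<close>

definition separations :: "nat \<Rightarrow> nat \<Rightarrow> (nat set \<times> nat set) set" where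
  "separations n k =
     {(A, S). A \<subseteq> {1..n} \<and> S \<subseteq> {1..n} - A \<and> 2 \<le> card A \<and> 2 * card A \<le> n \<and> card S < k}"

text \<open>The exponent \<open>max 1 (a - 2)\<close> is the surplus of edges meeting \<open>A\<close> over the \<open>a + s\<close> choices of
  vertices, in half-edges; it beats the number of choices of \<open>A\<close> and \<open>S\<close>.\<close>

definition sep_weight :: "nat \<Rightarrow> nat \<Rightarrow> nat \<Rightarrow> nat \<Rightarrow> real" where
  "sep_weight n k a s = 4 ^ (k * k) * (real (a + s) / real n) ^ (a + s)
     * sqrt (real (a + s) / real n) ^ max 1 (a - 2) * (real (n - a) / real n) ^ (n - a)"

lemma sep_weight_nonneg: "sep_weight n k a s \<ge> 0"
  by (simp add: sep_weight_def)

lemma finite_separations: "finite (separations n k)"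
  by (rule finite_subset[of _ "Pow {1..n} \<times> Pow {1..n}"]) (auto simp: separations_def)

lemma separationI:
  assumes "(A, S) \<in> separations n k" "4 * k \<le> n" "k \<ge> 2"
  shows "separation n k A ({1..n} - A - S) S"
proof
  have A: "A \<subseteq> {1..n}" "S \<subseteq> {1..n} - A" "2 \<le> card A" "2 * card A \<le> n" "card S < k"
    using assms(1) by (auto simp: separations_def)
  show "{1..n} - A - S \<noteq> {}"
  proof
    assume "{1..n} - A - S = {}"
    then have "card {1..n} \<le> card (A \<union> S)"
      using A by (intro card_mono) (auto intro: finite_subset)
    also have "\<dots> \<le> card A + card S"
      by (rule card_Un_le)
    finally show False
      using A assms by simp
  qed
  show "A \<noteq> {}" using A by auto
qed (use assms in \<open>auto simp: separations_def\<close>)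

section \<open>Existence and edge counts of separations\<close>

text \<open>Deleting a disconnecting set \<open>T\<close> leaves the component \<open>C\<close> of
  some vertex and the rest \<open>D\<close>; \<open>A\<close> is the smaller of the two. Replacing
  \<open>T\<close> by the outer neighbourhood \<open>S\<close> of \<open>A\<close>, a subset of
  \<open>T\<close>, keeps \<open>A\<close> cut off and makes every vertex of \<open>S\<close>
  adjacent to \<open>A\<close>.\<close>

lemma separation_exists:
  assumes E: "E \<subseteq> all_edges n" and deg: "k \<le> min_degree n E"
    and not_conn: "\<not> k_connected k {1..n} E" and kn: "k < n"
  obtains A S where "(A, S) \<in> separations n k" "separated E A ({1..n} - A - S)"
    "\<And>w. w \<in> S \<Longrightarrow> \<exists>v\<in>A. {v, w} \<in> E"
proof -
  obtain T u v where T: "T \<subseteq> {1..n}" "card T < k" and uv: "u \<in> {1..n} - T" "v \<in> {1..n} - T"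
    and nr: "(u, v) \<notin> {(x, y). x \<in> {1..n} - T \<and> y \<in> {1..n} - T \<and> {x, y} \<in> E}\<^sup>*"
    using not_conn kn by (auto simp: k_connected_def connected_graph_def)
  let ?R = "{(x, y). x \<in> {1..n} - T \<and> y \<in> {1..n} - T \<and> {x, y} \<in> E}"
  define C where "C = {w \<in> {1..n} - T. (u, w) \<in> ?R\<^sup>*}"
  define D where "D = {1..n} - T - C"
  have CD: "u \<in> C" "v \<in> D" "C \<inter> D = {}" "C \<union> D = {1..n} - T"
    using uv nr by (auto simp: C_def D_def)
  have no_edge: "{x, y} \<notin> E" if "x \<in> C" "y \<in> D" for x y
  proof
    assume "{x, y} \<in> E"
    then have "(x, y) \<in> ?R" using that CD by auto
    then have "(u, y) \<in> ?R\<^sup>*"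
      using that(1) by (auto simp: C_def intro: rtrancl_into_rtrancl)
    then show False using that(2) by (auto simp: D_def C_def)
  qed
  obtain A B where AB: "A \<noteq> {}" "B \<noteq> {}" "A \<inter> B = {}" "A \<union> B = {1..n} - T"
    "card A \<le> card B" "\<And>x y. x \<in> A \<Longrightarrow> y \<in> B \<Longrightarrow> {x, y} \<notin> E"
  proof (cases "card C \<le> card D")
    case True
    with CD no_edge that[of C D] show thesis by auto
  next
    case False
    have "{x, y} \<notin> E" if "x \<in> D" "y \<in> C" for x y
      using no_edge[OF that(2,1)] by (simp add: insert_commute)
    with CD False show thesis
      by (intro that[of D C]) auto
  qed
  define S where "S = {w \<in> {1..n} - A. \<exists>v\<in>A. {v, w} \<in> E}"
  have "A \<subseteq> {1..n}" "B \<subseteq> {1..n}"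
    using AB(4) by blast+
  with T(1) have fin: "finite A" "finite B" "finite T"
    by (meson finite_atLeastAtMost finite_subset)+
  have ST: "S \<subseteq> T"
    using AB(4,6) by (auto simp: S_def)
  with fin have card_S: "card S < k"
    using card_mono[of T S] T(2) by linarith
  have "2 * card A \<le> card A + card B" using AB(5) by simp
  also have "\<dots> = card (A \<union> B)"
    using fin AB(3) by (simp add: card_Un_disjoint)
  also have "\<dots> \<le> card {1..n}"
    using AB(4) by (intro card_mono) auto
  finally have half: "2 * card A \<le> n" by simp
  obtain x where x: "x \<in> A" using AB(1) by blast
  have A_sub: "A \<subseteq> {1..n}" using AB(4) by auto
  have "card A \<noteq> 1"
  proof
    assume "card A = 1"
    then obtain z where "A = {z}"
      by (rule card_1_singletonE)
    with x have A: "A = {x}" by simp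
    have "neighbours E x \<subseteq> S"
    proof
      fix w assume w: "w \<in> neighbours E x"
      then have "w \<in> {1..n} - A"
        using neighbours_subset[OF E, of x] A by blast
      moreover have "{x, w} \<in> E"
        using w by (simp add: neighbours_def)
      ultimately show "w \<in> S"
        unfolding S_def using x by blast
    qed
    then have "card (neighbours E x) \<le> card S"
      using ST fin by (intro card_mono) (auto intro: finite_subset)
    moreover have "k \<le> card (neighbours E x)"
      using deg min_degree_le[of x n E] x A_sub by auto
    ultimately show False using card_S by simp
  qed
  moreover have "card A > 0" using x fin by (auto simp: card_gt_0_iff)
  ultimately have "(A, S) \<in> separations n k"
    using half card_S A_sub by (auto simp: separations_def S_def)
  moreover have "separated E A ({1..n} - A - S)"
    unfolding separated_def
  proof (intro ballI)
    fix e assume e: "e \<in> E"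
    then obtain p q where pq: "e = {p, q}"
      by (metis E in_all_edgesE subsetD)
    show "e \<inter> A = {} \<or> e \<inter> ({1..n} - A - S) = {}"
    proof (rule ccontr)
      assume "\<not> ?thesis"
      then obtain x y where xy: "x \<in> e" "x \<in> A" "y \<in> e" "y \<in> {1..n} - A - S"
        by blast
      then have "e = {x, y}" using pq by blast
      with xy e show False unfolding S_def by blast
    qed
  qed
  moreover have "\<And>w. w \<in> S \<Longrightarrow> \<exists>v\<in>A. {v, w} \<in> E"
    by (auto simp: S_def)
  ultimately show thesis by (rule that)
qed

text \<open>Twice the edge count is at least \<open>k * card A + card ?R\<close>, where
  \<open>?R\<close> represents the edges leaving \<open>A\<close>. There are at least
  \<open>card S\<close> of those, as each vertex of \<open>S\<close> has a neighbour in
  \<open>A\<close>. There are also at least \<open>k * card A - card A * (card A - 1)\<close>, as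
  each vertex has at most \<open>card A - 1\<close> neighbours inside \<open>A\<close>.\<close>

lemma edges_meeting_small_side:
  assumes E: "E \<subseteq> all_edges n" and deg: "k \<le> min_degree n E"
    and AS: "(A, S) \<in> separations n k" and dom: "\<And>w. w \<in> S \<Longrightarrow> \<exists>v\<in>A. {v, w} \<in> E"
    and k: "k \<ge> 3"
  shows "2 * (card A + card S) + max 1 (card A - 2) \<le> 2 * card (touching E A)"
proof -
  have A: "A \<subseteq> {1..n}" "S \<subseteq> {1..n} - A" "2 \<le> card A" "card S < k"
    using AS by (auto simp: separations_def)
  have fE: "finite E" and fA: "finite A"
    using E A(1) finite_all_edges by (auto intro: finite_subset)
  let ?R = "{(x, w). x \<in> A \<and> w \<notin> A \<and> {x, w} \<in> E}"
  have R_sub: "?R \<subseteq> Sigma A (neighbours E)"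
    by (auto simp: neighbours_def)
  have fSig: "finite (Sigma A (neighbours E))"
    using fA fE by (auto intro: finite_neighbours)
  then have fR: "finite ?R"
    using R_sub by (rule rev_finite_subset)
  have sum_deg: "k * card A \<le> (\<Sum>x\<in>A. card (neighbours E x))"
  proof -
    have "(\<Sum>x\<in>A. k) \<le> (\<Sum>x\<in>A. card (neighbours E x))"
      using deg A(1) by (intro sum_mono order_trans[OF deg min_degree_le]) auto
    then show ?thesis by (simp add: mult.commute)
  qed
  have total: "k * card A + card ?R \<le> 2 * card (touching E A)"
    using two_card_touching_ge[OF E A(1)] sum_deg by linarith
  have "S \<subseteq> snd ` ?R"
  proof
    fix w assume w: "w \<in> S"
    then obtain v where "v \<in> A" "{v, w} \<in> E" using dom by blast
    moreover have "w \<notin> A" using w A(2) by auto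
    ultimately show "w \<in> snd ` ?R" by force
  qed
  then have cross_S: "card S \<le> card ?R"
    using fR by (meson card_image_le card_mono finite_imageI order_trans)
  have "Sigma A (neighbours E) \<subseteq> ?R \<union> (SIGMA x:A. A - {x})"
    by (auto simp: neighbours_def)
  then have "card (Sigma A (neighbours E)) \<le> card (?R \<union> (SIGMA x:A. A - {x}))"
    using fR fA by (intro card_mono) auto
  also have "\<dots> \<le> card ?R + card (SIGMA x:A. A - {x})"
    by (rule card_Un_le)
  also have "card (SIGMA x:A. A - {x}) = card A * (card A - 1)"
    using fA by (simp add: card_SigmaI)
  also have "card (Sigma A (neighbours E)) = (\<Sum>x\<in>A. card (neighbours E x))"
    using fA fE by (intro card_SigmaI) (auto intro: finite_neighbours)
  finally have cross: "k * card A \<le> card ?R + card A * (card A - 1)"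
    using sum_deg by linarith
  show ?thesis
  \<comment> \<open>For two vertices \<open>card ?R\<close> is at least \<open>2 * k - 2\<close>,
    and \<open>4 * k - 2\<close> beats \<open>2 * (2 + (k - 1)) + 1\<close> because
    \<open>k \<ge> 3\<close>. For larger \<open>A\<close> the bound \<open>card S\<close> on
    \<open>card ?R\<close> is enough.\<close>
  proof (cases "card A = 2")
    case True
    with total cross A(4) k show ?thesis by simp
  next
    case False
    obtain j where j: "k = 3 + j" using k le_Suc_ex by blast
    have "j * 3 \<le> j * card A"
      using False A(3) by (intro mult_left_mono) auto
    moreover have "k * card A = 3 * card A + j * card A"
      by (simp add: j distrib_right)
    moreover have "max 1 (card A - 2) + 2 = card A"
      using False A(3) by simp
    ultimately show ?thesis
      using total cross_S A(4) j unfolding distrib_left by linarith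
  qed
qed

text \<open>Write \<open>B\<close> for the complement. Degrees of at least \<open>3\<close> give
  \<open>3 * card B \<le> 2 * card (touching E B)\<close>. Since
  \<open>n - card A = card B + card S\<close>, it remains to see
  \<open>2 * card S \<le> card B\<close>, which follows from
  \<open>card B \<ge> n / 2 - card S\<close> and \<open>card S < k \<le> n / 6\<close>.\<close>

lemma edges_meeting_large_side:
  assumes E: "E \<subseteq> all_edges n" and deg: "k \<le> min_degree n E"
    and AS: "(A, S) \<in> separations n k" and k: "k \<ge> 3" and n: "6 * k \<le> n"
  shows "n - card A \<le> card (touching E ({1..n} - A - S))"
proof -
  let ?B = "{1..n} - A - S"
  interpret separation n k A ?B S
    using AS n k by (intro separationI) auto
  have half: "2 * card A \<le> n"
    using AS by (simp add: separations_def)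
  have "(\<Sum>x\<in>?B. k) \<le> (\<Sum>x\<in>?B. card (neighbours E x))"
    by (intro sum_mono order_trans[OF deg min_degree_le]) auto
  moreover have "(\<Sum>x\<in>?B. k) = card ?B * k"
    by simp
  moreover have "?B \<subseteq> {1..n}"
    by auto
  note two_card_touching_ge[OF E this]
  ultimately have "card ?B * k \<le> 2 * card (touching E ?B)"
    by linarith
  moreover have "card ?B * 3 \<le> card ?B * k"
    using k by (rule mult_le_mono2)
  ultimately have "3 * card ?B \<le> 2 * card (touching E ?B)"
    by linarith
  then show ?thesis
    using card_sum card_S half n by linarith
qed

lemma power_inverse_mult_power_ge_1:
  fixes z :: real
  assumes "z \<ge> 1" "m \<le> e"
  shows "(1 / z) ^ m * z ^ e \<ge> 1"
proof -
  have "z ^ m \<le> z ^ e" using assms by (intro power_increasing)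
  with assms show ?thesis by (simp add: power_divide)
qed

text \<open>The weight dominates the reciprocal of the potential factor by factor: \<open>f1\<close>
  treats the capped degrees over \<open>S\<close>, \<open>f2\<close> the edges meeting
  \<open>A\<close>, and \<open>f3\<close> those meeting \<open>?B\<close>.\<close>

lemma sep_weight_mult_potential_ge_1:
  assumes E: "E \<subseteq> all_edges n" and deg: "k \<le> min_degree n E"
    and AS: "(A, S) \<in> separations n k" and dom: "\<And>w. w \<in> S \<Longrightarrow> \<exists>v\<in>A. {v, w} \<in> E"
    and sep: "separated E A ({1..n} - A - S)"
    and k: "k \<ge> 3" and n: "6 * k \<le> n"
  shows "1 \<le> sep_weight n k (card A) (card S) * potential n k A ({1..n} - A - S) S E"
proof -
  let ?B = "{1..n} - A - S"
  interpret separation n k A ?B S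
    using AS n k by (intro separationI) auto
  interpret sw: separation n k ?B A S
    by (rule swap)
  define x where "x = real n / real (card A + card S)"
  define y where "y = real n / real (card ?B + card S)"
  define P where "P = (\<Sum>w\<in>S. min k (card (neighbours E w)))"
  let ?M = "max 1 (card A - 2)"
  have x: "x \<ge> 1" and y: "y \<ge> 1"
    unfolding x_def y_def by (rule ratio_ge_1 sw.ratio_ge_1)+
  have nA: "n - card A = card ?B + card S"
    using card_sum by linarith
  have w: "sep_weight n k (card A) (card S) = 4 ^ (k * k) * (1 / x) ^ (card A + card S)
      * sqrt (1 / x) ^ ?M * (1 / y) ^ (n - card A)"
    by (simp add: sep_weight_def x_def y_def nA)
  have p: "potential n k A ?B S E = x ^ card (touching E A) * y ^ card (touching E ?B) * (1 / 4) ^ P"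
    using sep by (simp add: potential_def x_def y_def P_def)
  have "P \<le> (\<Sum>w\<in>S. k)"
    unfolding P_def by (intro sum_mono) simp
  also have "\<dots> \<le> k * k"
    using card_S by simp
  finally have f1: "1 \<le> (1 / 4 :: real) ^ P * 4 ^ (k * k)"
    using power_inverse_mult_power_ge_1[of 4 P "k * k"] by simp
  have f2: "1 \<le> (1 / x) ^ (card A + card S) * sqrt (1 / x) ^ ?M * x ^ card (touching E A)"
  proof -
    \<comment> \<open>Passing to \<open>sqrt x\<close> doubles the exponents, so that the half-edges
      of \<open>edges_meeting_small_side\<close> are counted in integers.\<close>
    have "(1 / x) ^ (card A + card S) * sqrt (1 / x) ^ ?M * x ^ card (touching E A)
        = (1 / sqrt x) ^ (2 * (card A + card S) + ?M) * sqrt x ^ (2 * card (touching E A))"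
      using x by (simp add: real_sqrt_divide power_add power_mult power_divide)
    also have "\<dots> \<ge> 1"
      using x edges_meeting_small_side[OF E deg AS dom k]
      by (intro power_inverse_mult_power_ge_1) auto
    finally show ?thesis .
  qed
  have f3: "1 \<le> (1 / y) ^ (n - card A) * y ^ card (touching E ?B)"
    using y edges_meeting_large_side[OF E deg AS k n] by (intro power_inverse_mult_power_ge_1)
  have ge1: "1 \<le> a * b * c" if "1 \<le> a" "1 \<le> b" "1 \<le> c" for a b c :: real
    using mult_mono[of 1 "a * b" 1 c] mult_mono[of 1 a 1 b] that by simp
  show ?thesis
    using ge1[OF f1 f2 f3] unfolding w p by (simp only: mult_ac)
qed

text \<open>The potentials are supermartingales only while the minimum degree is below
  \<open>k\<close>. So \<open>U\<close> is the weighted sum \<open>V\<close> up to then, and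
  afterwards the indicator of the bad event, which cannot increase because added edges preserve both
  minimum degree at least \<open>k\<close> and \<open>k\<close>-connectedness. At the switch
  \<open>V\<close> dominates the indicator, since some separation contributes at least
  \<open>1\<close>. At the start all potentials are \<open>1\<close>.\<close>

lemma emeasure_not_k_connected_le:
  assumes k: "k \<ge> 3" and n: "6 * k \<le> n"
  shows "emeasure (run (star_step n) m {}) {E. k \<le> min_degree n E \<and> \<not> k_connected k {1..n} E}
     \<le> ennreal (\<Sum>(A, S)\<in>separations n k. sep_weight n k (card A) (card S))"
proof -
  let ?pot = "\<lambda>(A, S). potential n k A ({1..n} - A - S) S"
  let ?w = "\<lambda>(A, S). sep_weight n k (card A) (card S)"
  let ?bad = "{E. k \<le> min_degree n E \<and> \<not> k_connected k {1..n} E}"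
  define V where "V E = (\<Sum>p\<in>separations n k. ennreal (?w p) * ennreal (?pot p E))" for E
  define U where "U E = (if k \<le> min_degree n E then indicator ?bad E else V E)" for E
  have n2: "n \<ge> 2" using assms by simp
  have U_le: "U E \<le> V E" if "E \<subseteq> all_edges n" for E
  proof (cases "E \<in> ?bad")
    case True
    then have "k \<le> min_degree n E" "\<not> k_connected k {1..n} E" "k < n"
      using assms by auto
    from that this show ?thesis
    proof (rule separation_exists)
      fix A S
      assume AS: "(A, S) \<in> separations n k" "separated E A ({1..n} - A - S)"
        "\<And>w. w \<in> S \<Longrightarrow> \<exists>v\<in>A. {v, w} \<in> E"
      have "1 \<le> ennreal (?w (A, S) * ?pot (A, S) E)"
        using sep_weight_mult_potential_ge_1[OF that _ AS(1,3,2) assms] True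
        by (simp add: ennreal_leI[of 1, simplified])
      also have "\<dots> = ennreal (?w (A, S)) * ennreal (?pot (A, S) E)"
        by (simp add: ennreal_mult sep_weight_nonneg potential_nonneg)
      also have "\<dots> \<le> V E"
        unfolding V_def using AS(1) finite_separations by (intro member_le_sum) auto
      finally show ?thesis using True by (simp add: U_def)
    qed
  qed (auto simp: U_def)
  have step: "(\<integral>\<^sup>+E'. U E' \<partial>star_step n E) \<le> U E" if E: "E \<subseteq> all_edges n" for E
  proof (cases "k \<le> min_degree n E")
    case True
    have "(\<integral>\<^sup>+E'. U E' \<partial>star_step n E) \<le> (\<integral>\<^sup>+E'. U E \<partial>star_step n E)"
    proof (intro nn_integral_mono_AE, unfold AE_measure_pmf_iff, intro ballI)
      fix E' assume "E' \<in> set_pmf (star_step n E)"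
      from set_star_step[OF n2 E this] have E': "E \<subseteq> E'" "E' \<subseteq> all_edges n" .
      then have "min_degree n E \<le> min_degree n E'"
        using finite_all_edges by (intro min_degree_mono) (auto intro: finite_subset)
      with True k_connected_mono[OF E'(1), of k "{1..n}"] show "U E' \<le> U E"
        by (auto simp: U_def indicator_def)
    qed
    also have "\<dots> = U E" by simp
    finally show ?thesis .
  next
    case False
    have fE: "finite E" using E finite_all_edges by (rule finite_subset)
    have "(\<integral>\<^sup>+E'. U E' \<partial>star_step n E) \<le> (\<integral>\<^sup>+E'. V E' \<partial>star_step n E)"
      using set_star_step(2)[OF n2 E] U_le by (intro nn_integral_mono_AE) (auto simp: AE_measure_pmf_iff)
    also have "\<dots> = (\<Sum>p\<in>separations n k. ennreal (?w p) * (\<integral>\<^sup>+E'. ennreal (?pot p E') \<partial>star_step n E))"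
      unfolding V_def by (subst nn_integral_sum) (auto intro!: sum.cong nn_integral_cmult)
    also have "\<dots> \<le> V E"
      unfolding V_def
    proof (intro sum_mono mult_left_mono)
      fix p assume p: "p \<in> separations n k"
      obtain A S where AS: "p = (A, S)" by (cases p)
      interpret separation n k A "{1..n} - A - S" S
        using p assms AS by (intro separationI) auto
      show "(\<integral>\<^sup>+E'. ennreal (?pot p E') \<partial>star_step n E) \<le> ennreal (?pot p E)"
        using nn_integral_potential_le[OF fE] False AS by simp
    qed auto
    finally show ?thesis using False by (simp add: U_def)
  qed
  have "emeasure (run (star_step n) m {}) ?bad = (\<integral>\<^sup>+E. indicator ?bad E \<partial>run (star_step n) m {})"
    by simp
  also have "\<dots> \<le> (\<integral>\<^sup>+E. U E \<partial>run (star_step n) m {})"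
    by (intro nn_integral_mono) (auto simp: U_def indicator_def)
  also have "\<dots> \<le> U {}"
    by (rule nn_integral_run_le[where I = "{E. E \<subseteq> all_edges n}"])
       (use set_star_step(2)[OF n2] step in auto)
  also have "\<dots> \<le> V {}"
    by (rule U_le) simp
  also have "\<dots> = ennreal (\<Sum>p\<in>separations n k. ?w p)"
    by (simp add: V_def potential_empty case_prod_beta sep_weight_nonneg sum_ennreal)
  finally show ?thesis by (simp only:)
qed

section \<open>Summing the weights\<close>

lemma summable_power_mult_geometric: "summable (\<lambda>a. real (a + k) ^ j * (9 / 10) ^ a)"
proof (rule summable_comparison_test_bigo)
  \<comment> \<open>Any ratio strictly between \<open>9 / 10\<close> and \<open>1\<close> absorbs
    the polynomial factor.\<close>
  show "summable (\<lambda>a. norm ((19 / 20 :: real) ^ a))"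
    by (simp add: summable_geometric)
  show "(\<lambda>a. real (a + k) ^ j * (9 / 10) ^ a) \<in> O(\<lambda>a. (19 / 20) ^ a)"
    by real_asymp
qed

text \<open>The left-hand side is one term of the binomial expansion of
  \<open>(p + (1 - p)) ^ n\<close> with \<open>p = a / n\<close>.\<close>

lemma choose_mult_powers_le_1:
  assumes "a \<le> n" "n > 0"
  shows "real (n choose a) * (real a / real n) ^ a * (real (n - a) / real n) ^ (n - a) \<le> 1"
proof -
  let ?p = "real a / real n"
  have "real (n choose a) * ?p ^ a * (1 - ?p) ^ (n - a)
      \<le> (\<Sum>i\<le>n. real (n choose i) * ?p ^ i * (1 - ?p) ^ (n - i))"
    using assms by (intro member_le_sum) auto
  also have "\<dots> = (?p + (1 - ?p)) ^ n"
    by (rule binomial_ring[symmetric])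
  finally show ?thesis
    using assms by (simp add: of_nat_diff diff_divide_distrib)
qed

text \<open>Let \<xi> be \<open>(a + s) / n\<close>. Its power \<open>a\<close> exceeds
  \<open>(a / n) ^ a\<close> by a factor of at most \<open>exp s\<close>, so the binomial estimate
  absorbs \<open>n choose a\<close>; its power \<open>s\<close> absorbs \<open>n choose s\<close> up
  to a polynomial in \<open>a\<close>. One factor \<open>sqrt \<xi>\<close> supplies
  \<open>1 / sqrt n\<close>, and the others decay geometrically.\<close>

lemma sep_weight_le:
  assumes "2 \<le> a" "2 * a \<le> n" "s < k" "4 * k \<le> n"
  shows "real (n choose a) * real (n choose s) * sep_weight n k a s
     \<le> 4 ^ (k * k) * exp (real k) * real (a + k) ^ (k + 1) * (9 / 10) ^ (a - 3) / sqrt (real n)"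
proof -
  let ?\<xi> = "real (a + s) / real n"
  have n: "real n > 0" using assms by simp
  have \<xi>a: "?\<xi> ^ a \<le> (real a / real n) ^ a * exp (real k)"
  proof -
    have "?\<xi> = real a / real n * (1 + real s / real a)"
      using assms n by (simp add: field_simps)
    also have "\<dots> ^ a = (real a / real n) ^ a * (1 + real s / real a) ^ a"
      by (rule power_mult_distrib)
    also have "(1 + real s / real a) ^ a \<le> exp (real s / real a) ^ a"
      by (intro power_mono exp_ge_add_one_self) auto
    also have "exp (real s / real a) ^ a = exp (real s)"
      using assms by (simp flip: exp_of_nat_mult)
    also have "\<dots> \<le> exp (real k)"
      using assms by simp
    finally show ?thesis
      by (simp add: mult_left_mono)
  qed
  have chs: "real (n choose s) \<le> real n ^ s"
    using binomial_le_pow[of s n] assms by (simp flip: of_nat_power)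
  have \<xi>s: "real n ^ s * ?\<xi> ^ s \<le> real (a + k) ^ k"
  proof -
    have "real n ^ s * ?\<xi> ^ s = real (a + s) ^ s"
      using n by (simp add: power_divide)
    also have "\<dots> \<le> real (a + k) ^ s"
      using assms by (intro power_mono) auto
    also have "\<dots> \<le> real (a + k) ^ k"
      using assms by (intro power_increasing) auto
    finally show ?thesis .
  qed
  have sq: "sqrt ?\<xi> ^ max 1 (a - 2) \<le> real (a + k) * (9 / 10) ^ (a - 3) / sqrt (real n)"
  proof -
    have "sqrt ?\<xi> \<le> sqrt (real (a + k)) / sqrt (real n)"
      unfolding real_sqrt_divide[symmetric] using assms n
      by (intro real_sqrt_le_mono divide_right_mono) auto
    also have "sqrt (real (a + k)) \<le> real (a + k)"
      using assms by (intro real_le_lsqrt) (auto intro!: self_le_power)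
    finally have 1: "sqrt ?\<xi> \<le> real (a + k) / sqrt (real n)"
      using n by (simp add: divide_right_mono)
    \<comment> \<open>\<open>a \<le> n / 2\<close> and \<open>s < k \<le> n / 4\<close> give
      \<open>?\<xi> \<le> 3 / 4\<close>, below \<open>81 / 100\<close>.\<close>
    have "?\<xi> \<le> (9 / 10) ^ 2"
      using assms n by (simp add: field_simps power2_eq_square)
    then have 2: "sqrt ?\<xi> \<le> 9 / 10"
      by (intro real_le_lsqrt) auto
    \<comment> \<open>Subtraction is truncated: for \<open>a = 2\<close> both sides are
      \<open>1\<close>.\<close>
    have "max 1 (a - 2) = Suc (a - 3)" using assms by simp
    then have "sqrt ?\<xi> ^ max 1 (a - 2) = sqrt ?\<xi> * sqrt ?\<xi> ^ (a - 3)"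
      by (simp only: power_Suc)
    also have "\<dots> \<le> real (a + k) / sqrt (real n) * (9 / 10) ^ (a - 3)"
      using 1 2 by (intro mult_mono power_mono) auto
    finally show ?thesis by simp
  qed
  have "real (n choose a) * real (n choose s) * sep_weight n k a s =
      4 ^ (k * k) * (real (n choose a) * ?\<xi> ^ a * (real (n - a) / real n) ^ (n - a))
        * (real (n choose s) * ?\<xi> ^ s) * sqrt ?\<xi> ^ max 1 (a - 2)"
    unfolding sep_weight_def power_add by (simp only: mult_ac)
  also have "\<dots> \<le> 4 ^ (k * k) * exp (real k) * real (a + k) ^ k
      * (real (a + k) * (9 / 10) ^ (a - 3) / sqrt (real n))"
  proof (intro mult_mono sq mult_left_mono)
    have "real (n choose a) * ?\<xi> ^ a * (real (n - a) / real n) ^ (n - a)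
        \<le> real (n choose a) * ((real a / real n) ^ a * exp (real k)) * (real (n - a) / real n) ^ (n - a)"
      by (intro mult_right_mono mult_left_mono \<xi>a) auto
    also have "\<dots> = real (n choose a) * (real a / real n) ^ a * (real (n - a) / real n) ^ (n - a) * exp (real k)"
      by (simp only: mult_ac)
    also have "\<dots> \<le> 1 * exp (real k)"
      using assms by (intro mult_right_mono choose_mult_powers_le_1) auto
    finally show "real (n choose a) * ?\<xi> ^ a * (real (n - a) / real n) ^ (n - a) \<le> exp (real k)"
      by simp
    have "real (n choose s) * ?\<xi> ^ s \<le> real n ^ s * ?\<xi> ^ s"
      by (intro mult_right_mono chs) auto
    with \<xi>s show "real (n choose s) * ?\<xi> ^ s \<le> real (a + k) ^ k"
      by linarith
  qed auto
  also have "\<dots> = 4 ^ (k * k) * exp (real k) * real (a + k) ^ (k + 1) * (9 / 10) ^ (a - 3) / sqrt (real n)"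
    by (simp add: mult_ac)
  finally show ?thesis .
qed

text \<open>Group by the two cardinalities; forgetting that \<open>A\<close> and \<open>S\<close>
  are disjoint bounds each class by a product of binomial coefficients.\<close>

lemma sum_separations_le:
  assumes "\<And>a s. f a s \<ge> 0"
  shows "(\<Sum>(A, S)\<in>separations n k. f (card A) (card S))
     \<le> (\<Sum>a\<in>{2..n div 2}. \<Sum>s<k. real (n choose a) * real (n choose s) * f a s)"
proof -
  let ?T = "{2..n div 2} \<times> {..<k}" and ?g = "\<lambda>(A, S). (card A, card S)"
  have "(\<Sum>(A, S)\<in>separations n k. f (card A) (card S))
      = (\<Sum>t\<in>?T. \<Sum>p\<in>{p \<in> separations n k. ?g p = t}. case p of (A, S) \<Rightarrow> f (card A) (card S))"
    by (rule sum.group[OF finite_separations, symmetric]) (auto simp: separations_def)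
  also have "\<dots> \<le> (\<Sum>t\<in>?T. real (n choose fst t) * real (n choose snd t) * f (fst t) (snd t))"
  proof (rule sum_mono)
    fix t assume "t \<in> ?T"
    obtain a s where t: "t = (a, s)" by (cases t)
    let ?F = "{p \<in> separations n k. ?g p = t}"
    let ?B = "{A. A \<subseteq> {1..n} \<and> card A = a} \<times> {S. S \<subseteq> {1..n} \<and> card S = s}"
    have "finite ?B"
      by (rule finite_subset[of _ "Pow {1..n} \<times> Pow {1..n}"]) auto
    moreover have "?F \<subseteq> ?B"
      by (auto simp: separations_def t)
    ultimately have "card ?F \<le> card ?B"
      by (rule card_mono)
    also have "card ?B = (n choose a) * (n choose s)"
      using n_subsets[of "{1..n}" a] n_subsets[of "{1..n}" s] by (simp add: card_cartesian_product)
    finally have "real (card ?F) \<le> real (n choose a) * real (n choose s)"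
      by (simp flip: of_nat_mult)
    moreover have "(\<Sum>p\<in>?F. case p of (A, S) \<Rightarrow> f (card A) (card S)) = (\<Sum>p\<in>?F. f a s)"
      by (rule sum.cong) (auto simp: t)
    ultimately show "(\<Sum>p\<in>?F. case p of (A, S) \<Rightarrow> f (card A) (card S))
        \<le> real (n choose fst t) * real (n choose snd t) * f (fst t) (snd t)"
      using assms by (simp add: t mult_right_mono)
  qed
  also have "\<dots> = (\<Sum>a\<in>{2..n div 2}. \<Sum>s<k. real (n choose a) * real (n choose s) * f a s)"
    by (simp add: sum.cartesian_product case_prod_beta)
  finally show ?thesis .
qed

lemma sum_sep_weight_le:
  obtains C where "\<And>n. 4 * k \<le> n \<Longrightarrow>
     (\<Sum>(A, S)\<in>separations n k. sep_weight n k (card A) (card S)) \<le> C / sqrt (real n)"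
proof -
  \<comment> \<open>The factor \<open>k\<close> counts the values of \<open>s\<close>; dividing by
    \<open>(9 / 10) ^ 3\<close> turns the exponent \<open>a - 3\<close> into
    \<open>a\<close>.\<close>
  define D where "D = real k * (4 ^ (k * k) * exp (real k)) / (9 / 10) ^ 3"
  define g where "g a = real (a + k) ^ (k + 1) * (9 / 10) ^ a" for a :: nat
  have g: "summable g" "\<And>a. g a \<ge> 0"
    unfolding g_def by (rule summable_power_mult_geometric) simp
  have D: "D \<ge> 0" by (simp add: D_def)
  have "(\<Sum>(A, S)\<in>separations n k. sep_weight n k (card A) (card S)) \<le> D * suminf g / sqrt (real n)"
    if n: "4 * k \<le> n" for n
  proof -
    have "(\<Sum>(A, S)\<in>separations n k. sep_weight n k (card A) (card S))
      \<le> (\<Sum>a\<in>{2..n div 2}. \<Sum>s<k. real (n choose a) * real (n choose s) * sep_weight n k a s)"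
      by (rule sum_separations_le) (rule sep_weight_nonneg)
    also have "\<dots> \<le> (\<Sum>a\<in>{2..n div 2}. \<Sum>s<k.
        4 ^ (k * k) * exp (real k) * real (a + k) ^ (k + 1) * (9 / 10) ^ (a - 3) / sqrt (real n))"
      using n by (intro sum_mono sep_weight_le) auto
    also have "\<dots> \<le> (\<Sum>a\<in>{2..n div 2}. D / sqrt (real n) * g a)"
    proof (rule sum_mono)
      fix a
      have "(9 / 10 :: real) ^ (a - 3) \<le> (9 / 10) ^ a / (9 / 10) ^ 3"
      proof -
        have "(9 / 10 :: real) ^ (a - 3 + 3) \<le> (9 / 10) ^ a"
          by (rule power_decreasing) auto
        then show ?thesis by (simp add: power_add field_simps)
      qed
      then have "real k * (4 ^ (k * k) * exp (real k)) * real (a + k) ^ (k + 1) / sqrt (real n) * (9 / 10) ^ (a - 3)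
         \<le> real k * (4 ^ (k * k) * exp (real k)) * real (a + k) ^ (k + 1) / sqrt (real n) * ((9 / 10) ^ a / (9 / 10) ^ 3)"
        by (intro mult_left_mono) auto
      then show "(\<Sum>s<k. 4 ^ (k * k) * exp (real k) * real (a + k) ^ (k + 1) * (9 / 10) ^ (a - 3) / sqrt (real n))
          \<le> D / sqrt (real n) * g a"
        by (simp add: D_def g_def mult_ac)
    qed
    also have "\<dots> = D / sqrt (real n) * (\<Sum>a\<in>{2..n div 2}. g a)"
      by (rule sum_distrib_left[symmetric])
    also have "\<dots> \<le> D / sqrt (real n) * suminf g"
      using D g by (intro mult_left_mono sum_le_suminf) auto
    finally show ?thesis by simp
  qed
  then show thesis by (rule that)
qed

section \<open>The hitting time of the min-degree process\<close>

lemma length_Gmin_edges: "es \<in> set_pmf (Gmin_edges n m) \<Longrightarrow> length es = m"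
  by (induction m arbitrary: es) auto

text \<open>Every step only appends an edge. Hence the laws of the graphs at all times can be read
  off the single law \<open>Gmin_process\<close>.\<close>

lemma map_take_Gmin_edges: "map_pmf (take m) (Gmin_edges n (m + j)) = Gmin_edges n m"
proof (induction j)
  case 0
  have "map_pmf (take m) (Gmin_edges n m) = map_pmf (\<lambda>es. es) (Gmin_edges n m)"
    by (intro map_pmf_cong) (auto dest: length_Gmin_edges)
  then show ?case by simp
next
  case (Suc j)
  have "map_pmf (take m) (Gmin_edges n (m + Suc j))
      = bind_pmf (Gmin_edges n (m + j)) (\<lambda>es. return_pmf (take m es))"
    unfolding add_Suc_right Gmin_edges.simps map_bind_pmf map_return_pmf
    by (intro bind_pmf_cong) (simp_all add: length_Gmin_edges)
  then show ?case
    using Suc by (simp add: map_pmf_def)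
qed

lemma run_min_eq_map_process:
  assumes "m \<le> n choose 2"
  shows "run (min_step n) m {} = map_pmf (\<lambda>es. Gmin_graph es m) (Gmin_process n)"
proof -
  have "Gmin_edges n m = map_pmf (take m) (Gmin_process n)"
    using map_take_Gmin_edges[of m n "(n choose 2) - m"]
    unfolding le_add_diff_inverse[OF assms] Gmin_process_def by simp
  then show ?thesis
    by (simp add: map_set_Gmin_edges[symmetric] map_pmf_comp Gmin_graph_def)
qed

text \<open>Before \<open>n choose 2\<close> steps the graph is not complete, so each step adds a
  new edge. At the end this forces the complete graph.\<close>

lemma set_run_min_step:
  assumes "n > 0" "m \<le> n choose 2" "E \<in> set_pmf (run (min_step n) m {})"
  shows "E \<subseteq> all_edges n \<and> card E = m"
  using assms(2,3)
proof (induction m arbitrary: E)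
  case (Suc m)
  then obtain E0 where E0: "E0 \<in> set_pmf (run (min_step n) m {})" "E \<in> set_pmf (min_step n E0)"
    by auto
  with Suc have IH: "E0 \<subseteq> all_edges n" "card E0 = m"
    by auto
  have "E0 \<noteq> all_edges n"
    using IH(2) Suc.prems(1) card_all_edges[of n] by auto
  with IH(1) have "min_degree n E0 < n - 1"
    by (intro min_degree_less) auto
  from set_min_step[OF assms(1) IH(1) this E0(2)]
  obtain e where "e \<in> all_edges n" "e \<notin> E0" "E = insert e E0" .
  moreover have "finite E0"
    using IH(1) finite_all_edges by (rule finite_subset)
  ultimately show ?case
    using IH by simp
qed simp

lemma set_process:
  assumes "n > 0" "es \<in> set_pmf (Gmin_process n)"
  shows "set es = all_edges n"
proof -
  have "set es \<in> set_pmf (run (min_step n) (n choose 2) {})"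
    using assms(2) by (simp add: map_set_Gmin_edges[symmetric] Gmin_process_def)
  from set_run_min_step[OF assms(1) _ this] show ?thesis
    by (intro card_subset_eq finite_all_edges) (auto simp: card_all_edges)
qed

text \<open>The minimum degree is monotone along the process, and the least time is attained because
  the final graph is complete and \<open>k \<le> n - 1\<close>.\<close>

lemma hitting_time_le_iff:
  assumes "k < n" "es \<in> set_pmf (Gmin_process n)"
  shows "hitting_time k n es \<le> m \<longleftrightarrow> k \<le> min_degree n (Gmin_graph es m)"
proof
  assume "k \<le> min_degree n (Gmin_graph es m)"
  then show "hitting_time k n es \<le> m"
    unfolding hitting_time_def by (rule Least_le)
next
  assume le: "hitting_time k n es \<le> m"
  have "k \<le> min_degree n (Gmin_graph es (length es))"
    using set_process[OF _ assms(2)] min_degree_all_edges[of n] assms(1) by (simp add: Gmin_graph_def)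
  then have "k \<le> min_degree n (Gmin_graph es (hitting_time k n es))"
    unfolding hitting_time_def by (rule LeastI)
  also have "\<dots> \<le> min_degree n (Gmin_graph es m)"
    unfolding Gmin_graph_def using le by (intro min_degree_mono set_take_subset_set_take) auto
  finally show "k \<le> min_degree n (Gmin_graph es m)" .
qed

lemma prob_hitting_time_le:
  assumes "k < n" "m \<le> n choose 2"
  shows "measure_pmf.prob (Gmin_process n) {es. hitting_time k n es \<le> m}
       = measure_pmf.prob (run (min_step n) m {}) {E. k \<le> min_degree n E}"
proof -
  have "measure_pmf.prob (Gmin_process n) {es. hitting_time k n es \<le> m}
      = measure_pmf.prob (Gmin_process n) {es. k \<le> min_degree n (Gmin_graph es m)}"
    by (intro measure_pmf.finite_measure_eq_AE)
       (auto simp: AE_measure_pmf_iff hitting_time_le_iff[OF assms(1)])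
  also have "\<dots> = measure_pmf.prob (run (min_step n) m {}) {E. k \<le> min_degree n E}"
    by (simp add: run_min_eq_map_process[OF assms(2)] vimage_def)
  finally show ?thesis .
qed

text \<open>For large \<open>n\<close>, a linear number of steps stays within the length of
  \<open>Gmin_process\<close>.\<close>

lemma le_choose_two:
  assumes "real j \<le> c * real n" "2 * c + 1 \<le> real n"
  shows "j \<le> n choose 2"
proof -
  have n: "n \<ge> 1" if "j > 0"
    using assms that by (cases n) auto
  have "real (2 * j) \<le> real (n * (n - 1))" if "j > 0"
  proof -
    have "real (2 * j) \<le> (2 * c) * real n"
      using assms(1) by simp
    also have "\<dots> \<le> (real n - 1) * real n"
      using assms(2) by (intro mult_right_mono) auto
    finally show ?thesis
      using n[OF that] by (simp add: of_nat_diff mult.commute)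
  qed
  then have "2 * j \<le> n * (n - 1)"
    unfolding of_nat_le_iff by (cases "j > 0") auto
  then show ?thesis
    unfolding choose_two by linarith
qed

section \<open>The connectivity threshold\<close>

text \<open>Deleting fewer than \<open>k\<close> neighbours of \<open>u\<close> would cut
  \<open>u\<close> off from a remaining vertex \<open>v\<close>, which exists because
  \<open>k < n\<close>.\<close>

lemma k_connected_imp_min_degree_ge:
  assumes E: "E \<subseteq> all_edges n" and conn: "k_connected k {1..n} E"
  shows "k \<le> min_degree n E"
proof -
  have kn: "k < n" using conn by (simp add: k_connected_def)
  have "k \<le> card (neighbours E u)" if u: "u \<in> {1..n}" for u
  proof (rule ccontr)
    assume less: "\<not> ?thesis"
    let ?S = "neighbours E u"
    let ?R = "{(x, y). x \<in> {1..n} - ?S \<and> y \<in> {1..n} - ?S \<and> {x, y} \<in> E}"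
    have S: "?S \<subseteq> {1..n} - {u}"
      by (rule neighbours_subset[OF E])
    have "card ?S < card ({1..n} - {u})"
      using less kn card_others[OF u] by simp
    then have "?S \<noteq> {1..n} - {u}"
      by (metis less_irrefl)
    with S obtain v where v: "v \<in> {1..n}" "v \<noteq> u" "v \<notin> ?S"
      by blast
    have "?S \<subseteq> {1..n}" using S by blast
    then have "connected_graph ({1..n} - ?S) E"
      using conn less by (simp add: k_connected_def)
    then have "(u, v) \<in> ?R\<^sup>*"
      using u v S unfolding connected_graph_def by blast
    then obtain y where "(u, y) \<in> ?R"
    proof (cases rule: converse_rtranclE)
      case base
      with v(2) show ?thesis by simp
    qed (use that in blast)
    then have y: "{u, y} \<in> E" "y \<notin> ?S" by auto
    \<comment> \<open>A loop would be a one-element set, and those are not in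
      \<open>all_edges n\<close>.\<close>
    then have "y \<noteq> u"
      using E doubleton_in_all_edges[of u y n] by auto
    with y show False by (simp add: neighbours_def)
  qed
  with kn show ?thesis by (simp add: le_min_degree_iff)
qed

lemma prob_Gmin_star:
  "measure_pmf.prob (Gmin_star n m) {M. P (set_mset M)} = measure_pmf.prob (run (star_step n) m {}) {E. P E}"
  by (simp add: map_set_mset_Gmin_star[symmetric] vimage_def)

text \<open>\<open>k\<close>-connectedness forces minimum degree \<open>k\<close>, which the lazy
  multigraph chain is at most as likely to have reached as the simple one.\<close>

lemma prob_k_connected_le:
  assumes "n > k" "k > 0" "m \<le> n choose 2" "n \<ge> 2"
  shows "measure_pmf.prob (Gmin_star n m) {M. k_connected k {1..n} (set_mset M)}
     \<le> measure_pmf.prob (Gmin_process n) {es. hitting_time k n es \<le> m}"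
proof -
  have sub: "set_pmf (run (star_step n) m {}) \<subseteq> {E. E \<subseteq> all_edges n}"
    using set_star_step(2)[OF assms(4)] by (intro set_pmf_run_subset) auto
  have "measure_pmf.prob (Gmin_star n m) {M. k_connected k {1..n} (set_mset M)}
      = measure_pmf.prob (run (star_step n) m {}) {E. k_connected k {1..n} E}"
    by (rule prob_Gmin_star)
  also have "\<dots> \<le> measure_pmf.prob (run (star_step n) m {}) {E. k \<le> min_degree n E}"
  proof (intro measure_pmf.finite_measure_mono_AE, unfold AE_measure_pmf_iff, intro ballI impI)
    fix E assume "E \<in> set_pmf (run (star_step n) m {})" "E \<in> {E. k_connected k {1..n} E}"
    with sub show "E \<in> {E. k \<le> min_degree n E}"
      using k_connected_imp_min_degree_ge[of E n k] by blast
  qed simp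
  also have "\<dots> \<le> measure_pmf.prob (run (min_step n) m {}) {E. k \<le> min_degree n E}"
    using run_star_le_run_min[of k n "{}" m] assms by (simp add: measure_pmf.emeasure_eq_measure)
  finally show ?thesis
    using assms by (simp add: prob_hitting_time_le)
qed

lemma prob_not:
  "measure_pmf.prob p {x. \<not> P x} = 1 - measure_pmf.prob p {x. P x}"
proof -
  have "{x. \<not> P x} = UNIV - {x. P x}" by auto
  then show ?thesis
    using measure_pmf.prob_compl[of "{x. P x}" p] by simp
qed

text \<open>One summand per source of failure: the simple process is still below minimum degree
  \<open>k\<close> after \<open>j\<close> steps; more than \<open>m - j\<close> of the
  \<open>m\<close> multigraph steps are repetitions; or minimum degree \<open>k\<close> is reached
  with a separation present.\<close>

lemma prob_not_k_connected_le:
  assumes "k \<ge> 3" "6 * k \<le> n" "j \<le> n choose 2"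
    and C: "(\<Sum>(A, S)\<in>separations n k. sep_weight n k (card A) (card S)) \<le> C"
  shows "measure_pmf.prob (Gmin_star n m) {M. \<not> k_connected k {1..n} (set_mset M)}
     \<le> measure_pmf.prob (Gmin_process n) {es. \<not> hitting_time k n es \<le> j}
       + 2 ^ j * ((1 + real (k - 1) / real (n - 1)) / 2) ^ m + C"
proof -
  let ?H = "measure_pmf (run (star_step n) m {})"
  have C0: "0 \<le> C"
    by (rule order_trans[OF sum_nonneg C]) (auto simp: sep_weight_nonneg)
  have "measure_pmf.prob (Gmin_star n m) {M. \<not> k_connected k {1..n} (set_mset M)}
      = measure ?H {E. \<not> k_connected k {1..n} E}"
    by (rule prob_Gmin_star)
  also have "\<dots> \<le> measure ?H ({E. min_degree n E < k} \<union> {E. k \<le> min_degree n E \<and> \<not> k_connected k {1..n} E})"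
    by (intro measure_pmf.finite_measure_mono) auto
  also have "\<dots> \<le> measure ?H {E. min_degree n E < k} + measure ?H {E. k \<le> min_degree n E \<and> \<not> k_connected k {1..n} E}"
    by (rule measure_Un_le) auto
  also have "measure ?H {E. k \<le> min_degree n E \<and> \<not> k_connected k {1..n} E} \<le> C"
  proof -
    have "ennreal (measure ?H {E. k \<le> min_degree n E \<and> \<not> k_connected k {1..n} E}) \<le> ennreal C"
      unfolding measure_pmf.emeasure_eq_measure[symmetric]
      by (rule order_trans[OF emeasure_not_k_connected_le[OF assms(1,2)] ennreal_leI[OF C]])
    with C0 show ?thesis by simp
  qed
  also have "measure ?H {E. min_degree n E < k}
      \<le> measure_pmf.prob (run (min_step n) j {}) {E. min_degree n E < k}
        + 2 ^ j * ((1 + real (k - 1) / real (n - 1)) / 2) ^ m"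
  proof -
    have "ennreal (measure ?H {E. min_degree n E < k})
      \<le> ennreal (measure_pmf.prob (run (min_step n) j {}) {E. min_degree n E < k}
        + 2 ^ j * ((1 + real (k - 1) / real (n - 1)) / 2) ^ m)"
      using run_star_le_run_min_add[of k n "{}" m j] assms
      by (simp add: measure_pmf.emeasure_eq_measure ennreal_plus)
    then show ?thesis
      by (subst (asm) ennreal_le_iff) auto
  qed
  also have "measure_pmf.prob (run (min_step n) j {}) {E. min_degree n E < k}
      = measure_pmf.prob (Gmin_process n) {es. \<not> hitting_time k n es \<le> j}"
  proof -
    have "measure_pmf.prob (run (min_step n) j {}) {E. \<not> k \<le> min_degree n E}
      = measure_pmf.prob (Gmin_process n) {es. \<not> hitting_time k n es \<le> j}"
      unfolding prob_not using assms by (subst prob_hitting_time_le) auto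
    then show ?thesis by (simp only: not_le)
  qed
  finally show ?thesis by simp
qed

section \<open>Asymptotics in \<open>n\<close>\<close>

text \<open>Hitting times are nonnegative, so for \<open>h < 0\<close> and \<epsilon> equal to
  \<open>- h / 2\<close> the event in the definition is empty as soon as
  \<open>n > 0\<close>.\<close>

lemma is_min_degree_constant_nonneg:
  assumes "is_min_degree_constant k h"
  shows "h \<ge> 0"
proof (rule ccontr)
  assume "\<not> h \<ge> 0"
  then have h: "h < 0" by simp
  let ?f = "\<lambda>n. measure_pmf.prob (Gmin_process n)
      {es. \<bar>real (hitting_time k n es) - h * real n\<bar> \<le> - h / 2 * real n}"
  have "- h / 2 > 0" using h by simp
  with assms have "?f \<longlonglongrightarrow> 1"
    unfolding is_min_degree_constant_def whp_def by blast
  moreover have "eventually (\<lambda>n. ?f n = 0) sequentially"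
    using eventually_gt_at_top[of 0]
  proof eventually_elim
    case (elim n)
    have "- h / 2 * real n < real x - h * real n" for x
    proof -
      have "h * real n < 0" using h elim by (simp add: mult_less_0_iff)
      then show ?thesis by simp
    qed
    then have "{es. \<bar>real (hitting_time k n es) - h * real n\<bar> \<le> - h / 2 * real n} = {}"
      by (auto simp: abs_le_iff not_le)
    then show ?case by simp
  qed
  then have "?f \<longlonglongrightarrow> 0"
    by (rule tendsto_eventually)
  ultimately show False
    using LIMSEQ_unique by fastforce
qed

text \<open>With \<open>j\<close> and \<open>m\<close> the two rounded step counts and
  \<open>q = (k - 1) / (n - 1)\<close>, the power \<open>(1 + q) ^ m\<close> stays bounded because
  \<open>q * n \<le> 2 * k\<close>, while \<open>2 powr (j - m)\<close> decays
  exponentially.\<close>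

lemma repeated_edges_bound_tendsto_0:
  fixes \<alpha> \<beta> :: real
  assumes "0 \<le> \<beta>" "\<beta> < \<alpha>"
  shows "(\<lambda>n. 2 ^ nat \<lfloor>\<beta> * real n\<rfloor> * ((1 + real (k - 1) / real (n - 1)) / 2) ^ nat \<lfloor>\<alpha> * real n\<rfloor>) \<longlonglongrightarrow> (0 :: real)"
proof (rule tendsto_sandwich)
  let ?b = "\<lambda>n. exp (2 * real k * \<alpha>) * (2 * 2 powr (- (\<alpha> - \<beta>) * real n))"
  show "(\<lambda>_. 0) \<longlonglongrightarrow> (0 :: real)" by simp
  define \<gamma> where "\<gamma> = \<alpha> - \<beta>"
  have "\<gamma> > 0" using assms by (simp add: \<gamma>_def)
  then have "(\<lambda>n. exp (2 * real k * \<alpha>) * (2 * 2 powr (- \<gamma> * real n))) \<longlonglongrightarrow> 0"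
    by real_asymp
  then show "?b \<longlonglongrightarrow> 0"
    unfolding \<gamma>_def .
  show "eventually (\<lambda>n. 2 ^ nat \<lfloor>\<beta> * real n\<rfloor> * ((1 + real (k - 1) / real (n - 1)) / 2) ^ nat \<lfloor>\<alpha> * real n\<rfloor> \<le> ?b n) sequentially"
    using eventually_ge_at_top[of 2]
  proof eventually_elim
    case (elim n)
    let ?j = "nat \<lfloor>\<beta> * real n\<rfloor>" and ?m = "nat \<lfloor>\<alpha> * real n\<rfloor>"
    define q where "q = real (k - 1) / real (n - 1)"
    have q: "0 \<le> q" "q * real n \<le> 2 * real k"
    proof -
      show "0 \<le> q" by (simp add: q_def)
      have "q * real n \<le> q * (2 * real (n - 1))"
        using elim by (intro mult_left_mono) (auto simp: q_def)
      also have "\<dots> = 2 * (q * real (n - 1))"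
        by (simp only: mult_ac)
      also have "q * real (n - 1) = real (k - 1)"
        using elim by (simp add: q_def del: of_nat_diff)
      finally show "q * real n \<le> 2 * real k" by simp
    qed
    have j: "real ?j \<le> \<beta> * real n" and m: "real ?m \<le> \<alpha> * real n" "\<alpha> * real n - 1 \<le> real ?m"
      using assms by simp_all
    have "(1 + q) ^ ?m \<le> exp q ^ ?m"
      using q by (intro power_mono exp_ge_add_one_self) auto
    also have "\<dots> = exp (real ?m * q)"
      by (rule exp_of_nat_mult[symmetric])
    also have "\<dots> \<le> exp (2 * real k * \<alpha>)"
    proof -
      have "real ?m * q \<le> \<alpha> * real n * q"
        using m q by (intro mult_right_mono) auto
      also have "\<dots> = \<alpha> * (q * real n)"
        by simp
      also have "\<dots> \<le> \<alpha> * (2 * real k)"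
        using q assms by (intro mult_left_mono) auto
      finally show ?thesis by (simp add: mult_ac)
    qed
    finally have 1: "(1 + q) ^ ?m \<le> exp (2 * real k * \<alpha>)" .
    have "(2 :: real) ^ ?j / 2 ^ ?m = 2 powr (real ?j - real ?m)"
      by (simp add: powr_diff powr_realpow)
    \<comment> \<open>The summand \<open>1\<close> pays for rounding \<open>\<alpha> * n\<close>
      down.\<close>
    also have "\<dots> \<le> 2 powr (1 + - (\<alpha> - \<beta>) * real n)"
      using j m by (intro powr_mono) (auto simp: algebra_simps)
    also have "\<dots> = 2 * 2 powr (- (\<alpha> - \<beta>) * real n)"
      by (simp only: powr_add) simp
    finally have 2: "(2 :: real) ^ ?j / 2 ^ ?m \<le> 2 * 2 powr (- (\<alpha> - \<beta>) * real n)" .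
    have "2 ^ ?j * ((1 + q) / 2) ^ ?m = (1 + q) ^ ?m * (2 ^ ?j / 2 ^ ?m)"
      by (simp add: power_divide)
    also have "\<dots> \<le> ?b n"
      using q by (intro mult_mono 1 2) auto
    finally show ?case by (simp only: q_def)
  qed
qed (auto intro!: always_eventually)

lemma whp_compl:
  assumes "eventually (\<lambda>n. measure_pmf.prob (X n) {x. \<not> P n x} \<le> f n) sequentially" "f \<longlonglongrightarrow> 0"
  shows "whp X P"
  unfolding whp_def
proof (rule tendsto_sandwich)
  show "(\<lambda>n. 1 - f n) \<longlonglongrightarrow> 1"
    using tendsto_diff[OF tendsto_const assms(2), of 1] by simp
  show "eventually (\<lambda>n. 1 - f n \<le> measure_pmf.prob (X n) {x. P n x}) sequentially"
    using assms(1)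
    by eventually_elim (simp add: prob_not)
qed (auto intro!: always_eventually measure_pmf.prob_le_1)

lemma whp_failure_tendsto_0:
  assumes "whp X P"
  shows "(\<lambda>n. measure_pmf.prob (X n) {x. \<not> P n x}) \<longlonglongrightarrow> 0"
  using tendsto_diff[OF tendsto_const assms[unfolded whp_def], of 1] by (simp add: prob_not)

theorem theorem5p8:
  fixes k :: nat and h \<alpha> :: real
  assumes "k \<ge> 3"
    and "is_min_degree_constant k h"
    and "\<alpha> \<ge> 0"
  shows "(\<alpha> > h \<longrightarrow>
            whp (\<lambda>n. Gmin_star n (nat \<lfloor>\<alpha> * real n\<rfloor>)) (\<lambda>n M. k_connected k {1..n} (set_mset M)))
       \<and> (\<alpha> < h \<longrightarrow>
            whp (\<lambda>n. Gmin_star n (nat \<lfloor>\<alpha> * real n\<rfloor>)) (\<lambda>n M. \<not> k_connected k {1..n} (set_mset M)))"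
proof (intro conjI impI)
  define dev where "dev \<epsilon> n = measure_pmf.prob (Gmin_process n)
      {es. \<not> \<bar>real (hitting_time k n es) - h * real n\<bar> \<le> \<epsilon> * real n}" for \<epsilon> n
  have dev: "dev \<epsilon> \<longlonglongrightarrow> 0" if "\<epsilon> > 0" for \<epsilon>
    unfolding dev_def using assms(2) that
    by (intro whp_failure_tendsto_0) (simp add: is_min_degree_constant_def)
  have h: "h \<ge> 0"
    using assms(2) by (rule is_min_degree_constant_nonneg)
  {
    assume "h < \<alpha>"
    \<comment> \<open>This makes \<beta> the midpoint of \<open>h\<close> and \<alpha>: w.h.p. the
      simple process needs at most \<open>\<beta> * n\<close> steps, and the other
      \<open>(\<alpha> - \<beta>) * n\<close> steps leave room for repetitions.\<close>
    define \<epsilon> where "\<epsilon> = (\<alpha> - h) / 2"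
    define \<beta> where "\<beta> = h + \<epsilon>"
    have \<epsilon>: "\<epsilon> > 0" and \<beta>: "0 \<le> \<beta>" "\<beta> < \<alpha>"
      using h \<open>h < \<alpha>\<close> by (auto simp: \<epsilon>_def \<beta>_def field_simps)
    obtain C where C: "\<And>n. 4 * k \<le> n \<Longrightarrow>
        (\<Sum>(A, S)\<in>separations n k. sep_weight n k (card A) (card S)) \<le> C / sqrt (real n)"
      using sum_sep_weight_le[of k] by blast
    let ?r = "\<lambda>n. 2 ^ nat \<lfloor>\<beta> * real n\<rfloor> * ((1 + real (k - 1) / real (n - 1)) / 2) ^ nat \<lfloor>\<alpha> * real n\<rfloor>"
    have "(\<lambda>n. C / sqrt (real n)) \<longlonglongrightarrow> 0"
      by real_asymp
    then have lim: "(\<lambda>n. dev \<epsilon> n + ?r n + C / sqrt (real n)) \<longlonglongrightarrow> 0"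
      using tendsto_add[OF tendsto_add[OF dev[OF \<epsilon>] repeated_edges_bound_tendsto_0[OF \<beta>, of k]]] by simp
    have "eventually (\<lambda>n. 2 * \<beta> + 1 \<le> real n) sequentially"
      by real_asymp
    then have "eventually (\<lambda>n. measure_pmf.prob (Gmin_star n (nat \<lfloor>\<alpha> * real n\<rfloor>))
        {M. \<not> k_connected k {1..n} (set_mset M)} \<le> dev \<epsilon> n + ?r n + C / sqrt (real n)) sequentially"
      using eventually_ge_at_top[of "6 * k"]
    proof eventually_elim
      case (elim n)
      have j: "real (nat \<lfloor>\<beta> * real n\<rfloor>) \<le> \<beta> * real n"
        using \<beta> by simp
      have "measure_pmf.prob (Gmin_star n (nat \<lfloor>\<alpha> * real n\<rfloor>)) {M. \<not> k_connected k {1..n} (set_mset M)}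
        \<le> measure_pmf.prob (Gmin_process n) {es. \<not> hitting_time k n es \<le> nat \<lfloor>\<beta> * real n\<rfloor>}
          + ?r n + C / sqrt (real n)"
        using elim assms(1) by (intro prob_not_k_connected_le le_choose_two[OF j] C) auto
      moreover have "measure_pmf.prob (Gmin_process n) {es. \<not> hitting_time k n es \<le> nat \<lfloor>\<beta> * real n\<rfloor>} \<le> dev \<epsilon> n"
        unfolding dev_def
      proof (intro measure_pmf.finite_measure_mono subsetI CollectI notI; (elim CollectE)?)
        fix es
        assume "\<not> hitting_time k n es \<le> nat \<lfloor>\<beta> * real n\<rfloor>"
          and "\<bar>real (hitting_time k n es) - h * real n\<bar> \<le> \<epsilon> * real n"
        moreover from this have "real (hitting_time k n es) \<le> \<beta> * real n"
          by (simp add: \<beta>_def algebra_simps)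
        ultimately show False
          by (simp add: le_nat_floor)
      qed simp
      ultimately show ?case by linarith
    qed
    then show "whp (\<lambda>n. Gmin_star n (nat \<lfloor>\<alpha> * real n\<rfloor>)) (\<lambda>n M. k_connected k {1..n} (set_mset M))"
      using lim by (rule whp_compl)
  }
  {
    assume "\<alpha> < h"
    \<comment> \<open>With half the gap, \<open>h - \<epsilon> = \<alpha> + \<epsilon>\<close>, so
      for \<open>n > 0\<close> a hitting time of at most \<open>\<alpha> * n\<close> deviates from
      \<open>h * n\<close> by more than \<open>\<epsilon> * n\<close>.\<close>
    define \<epsilon> where "\<epsilon> = (h - \<alpha>) / 2"
    have \<epsilon>: "\<epsilon> > 0"
      using \<open>\<alpha> < h\<close> by (simp add: \<epsilon>_def)
    have "eventually (\<lambda>n. 2 * \<alpha> + 1 \<le> real n) sequentially"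
      by real_asymp
    then have "eventually (\<lambda>n. measure_pmf.prob (Gmin_star n (nat \<lfloor>\<alpha> * real n\<rfloor>))
        {M. \<not> \<not> k_connected k {1..n} (set_mset M)} \<le> dev \<epsilon> n) sequentially"
      using eventually_ge_at_top[of "6 * k"]
    proof eventually_elim
      case (elim n)
      have m: "real (nat \<lfloor>\<alpha> * real n\<rfloor>) \<le> \<alpha> * real n"
        using assms(3) by simp
      have "measure_pmf.prob (Gmin_star n (nat \<lfloor>\<alpha> * real n\<rfloor>)) {M. k_connected k {1..n} (set_mset M)}
          \<le> measure_pmf.prob (Gmin_process n) {es. hitting_time k n es \<le> nat \<lfloor>\<alpha> * real n\<rfloor>}"
        using elim assms(1) by (intro prob_k_connected_le le_choose_two[OF m]) auto
      also have "\<dots> \<le> dev \<epsilon> n"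
        unfolding dev_def
      proof (intro measure_pmf.finite_measure_mono subsetI CollectI notI; (elim CollectE)?)
        fix es
        assume "hitting_time k n es \<le> nat \<lfloor>\<alpha> * real n\<rfloor>"
          and "\<bar>real (hitting_time k n es) - h * real n\<bar> \<le> \<epsilon> * real n"
        then have "h * real n - \<epsilon> * real n \<le> \<alpha> * real n"
          using m by linarith
        moreover have "h - \<epsilon> = \<alpha> + \<epsilon>"
          by (simp add: \<epsilon>_def field_simps)
        ultimately have "(\<alpha> + \<epsilon>) * real n \<le> \<alpha> * real n"
          by (metis left_diff_distrib)
        then show False
          using \<epsilon> elim assms(1) by simp
      qed simp
      finally show ?case by simp
    qed
    then show "whp (\<lambda>n. Gmin_star n (nat \<lfloor>\<alpha> * real n\<rfloor>)) (\<lambda>n M. \<not> k_connected k {1..n} (set_mset M))"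
      using dev[OF \<epsilon>] by (rule whp_compl)
  }
qed

end
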